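(* Under the standing setting: (a) If $f_0=0$ and $f_\infty=\infty$, then for every $\lambda\in(0,\infty)$ problem (P$_\lambda$) has a positive solution $u_\lambda$, and these solutions can be chosen so that $\|u_\lambda\|_\infty\to\infty$ as $\lambda\to0^+$ and $\|u_\lambda\|_\infty\to0$ as $\lambda\to\infty$. (b) If $f_0=\infty$ and $f_\infty=0$, then for every $\lambda\in(0,\infty)$ problem (P$_\lambda$) has a positive solution $u_\lambda$, and these can be chosen so that $\|u_\lambda\|_\infty\to0$ as $\lambda\to0^+$ and $\|u_\lambda\|_\infty\to\infty$ as $\lambda\to\infty$.
   Context: Standing setting. $\varphi:\mathbb{R}\to\mathbb{R}$ is an odd, increasing homeomorphism satisfying condition (A): there exist increasing homeomorphisms $\psi_1,\psi_2:[0,\infty)\to[0,\infty)$ such that $\varphi(x)\psi_1(y)\le \varphi(xy)\le \varphi(x)\psi_2(y)$ for all $x,y\ge 0$. Let $c,d\in C([0,1],(0,\infty))$, and $\|\cdot\|_\infty$ the maximum norm on $C[0,1]$. Let $f\in C([0,\infty),[0,\infty))$ with $f(s)>0$ for $s>0$, and write $f_0=\lim_{s\to0^+}f(s)/\varphi(s)$, $f_\infty=\lim_{s\to\infty}f(s)/\varphi(s)$ (assumed to exist in $[0,\infty]$ whenever referred to). Let $h\in C((0,1),[0,\infty))$, $h\not\equiv 0$, with $\int_0^{1/2}\psi_1^{-1}\big(\int_s^{1/2}h(\tau)d\tau\big)ds+\int_{1/2}^1\psi_1^{-1}\big(\int_{1/2}^s h(\tau)d\tau\big)ds<\infty$. Notation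 attached to $h$: $\alpha_h=\sup\{x\in(0,1): h=0 \text{ on }(0,x)\}$ ($0$ if empty); $\beta_h=\inf\{x\in(0,1): h=0\text{ on }(x,1)\}$ ($1$ if empty); $\bar\alpha_h=\sup\{x\in(\alpha_h,1]: h>0 \text{ on }(\alpha_h,x)\}$; $\bar\beta_h=\inf\{x\in[0,\beta_h): h>0\text{ on }(x,\beta_h)\}$; $\gamma_h^1=(3\alpha_h+\bar\alpha_h)/4$, $\gamma_h^2=(\bar\beta_h+3\beta_h)/4$. It is assumed that $0\le\alpha_h<\gamma_h^1<\gamma_h^2<\beta_h\le 1$. For $\lambda\ge0$, problem (P$_\lambda$) is: $(d(t)\varphi(c(t)u'(t)))'+\lambda h(t)f(u(t))=0$ for $t\in(0,1)$, $u(0)=u(1)=0$. A solution is $u\in C[0,1]\cap C^1(0,1)$ such that $t\mapsto d(t)\varphi(c(t)u'(t))$ is continuously differentiable on $(0,1)$ and the equation and boundary conditions hold; it is positive if $u(t)>0$ for all $t\in(0,1)$. *)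

theory Defs
  imports "HOL-Analysis.Analysis"
begin

definition incr_homeo_nonneg :: "(real \<Rightarrow> real) \<Rightarrow> bool" where
  "incr_homeo_nonneg \<psi> \<longleftrightarrow>
     strict_mono_on {0..} \<psi> \<and> continuous_on {0..} \<psi> \<and> \<psi> ` {0..} = {0..}"

definition odd_incr_homeo :: "(real \<Rightarrow> real) \<Rightarrow> bool" where
  "odd_incr_homeo \<phi> \<longleftrightarrow>
     strict_mono \<phi> \<and> continuous_on UNIV \<phi> \<and> surj \<phi> \<and> (\<forall>x. \<phi> (-x) = - \<phi> x)"

definition condA :: "(real \<Rightarrow> real) \<Rightarrow> (real \<Rightarrow> real) \<Rightarrow> (real \<Rightarrow> real) \<Rightarrow> bool" where
  "condA \<phi> \<psi>1 \<psi>2 \<longleftrightarrow> incr_homeo_nonneg \<psi>1 \<and> incr_homeo_nonneg \<psi>2 \<and>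
     (\<forall>x\<ge>0. \<forall>y\<ge>0. \<phi> x * \<psi>1 y \<le> \<phi> (x * y) \<and> \<phi> (x * y) \<le> \<phi> x * \<psi>2 y)"

definition h_integrability :: "(real \<Rightarrow> real) \<Rightarrow> (real \<Rightarrow> real) \<Rightarrow> bool" where
  "h_integrability \<psi>1 h \<longleftrightarrow>
     (\<integral>\<^sup>+ s\<in>{0<..1/2}. ennreal (inv_into {0..} \<psi>1 (integral {s..1/2} h)) \<partial>lborel)
   + (\<integral>\<^sup>+ s\<in>{1/2..<1}. ennreal (inv_into {0..} \<psi>1 (integral {1/2..s} h)) \<partial>lborel) < \<infinity>"

definition alpha_h :: "(real \<Rightarrow> real) \<Rightarrow> real" where
  "alpha_h h = (let S = {x\<in>{0<..<1}. \<forall>t\<in>{0<..<x}. h t = 0} in if S = {} then 0 else Sup S)"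

definition beta_h :: "(real \<Rightarrow> real) \<Rightarrow> real" where
  "beta_h h = (let S = {x\<in>{0<..<1}. \<forall>t\<in>{x<..<1}. h t = 0} in if S = {} then 1 else Inf S)"

text \<open>Convention: the supremum of the empty subset of (alpha,1] is alpha (resp. the infimum
  of the empty subset of [0,beta) is beta).\<close>
definition alpha_bar_h :: "(real \<Rightarrow> real) \<Rightarrow> real" where
  "alpha_bar_h h = (let a = alpha_h h; S = {x\<in>{a<..1}. \<forall>t\<in>{a<..<x}. h t > 0}
                    in if S = {} then a else Sup S)"

definition beta_bar_h :: "(real \<Rightarrow> real) \<Rightarrow> real" where
  "beta_bar_h h = (let b = beta_h h; S = {x\<in>{0..<b}. \<forall>t\<in>{x<..<b}. h t > 0}
                   in if S = {} then b else Inf S)"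

definition gamma1_h :: "(real \<Rightarrow> real) \<Rightarrow> real" where
  "gamma1_h h = (3 * alpha_h h + alpha_bar_h h) / 4"

definition gamma2_h :: "(real \<Rightarrow> real) \<Rightarrow> real" where
  "gamma2_h h = (beta_bar_h h + 3 * beta_h h) / 4"

definition is_solution ::
  "(real \<Rightarrow> real) \<Rightarrow> (real \<Rightarrow> real) \<Rightarrow> (real \<Rightarrow> real) \<Rightarrow> (real \<Rightarrow> real) \<Rightarrow> (real \<Rightarrow> real)
   \<Rightarrow> real \<Rightarrow> (real \<Rightarrow> real) \<Rightarrow> bool" where
  "is_solution \<phi> c d h f lam u \<longleftrightarrow>
     continuous_on {0..1} u \<and>
     (\<exists>u'. (\<forall>t\<in>{0<..<1}. (u has_real_derivative u' t) (at t)) \<and> continuous_on {0<..<1} u' \<and>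
       (\<exists>w'. (\<forall>t\<in>{0<..<1}. ((\<lambda>s. d s * \<phi> (c s * u' s)) has_real_derivative w' t) (at t)) \<and>
             continuous_on {0<..<1} w' \<and>
             (\<forall>t\<in>{0<..<1}. w' t + lam * h t * f (u t) = 0))) \<and>
     u 0 = 0 \<and> u 1 = 0"

definition is_positive_solution ::
  "(real \<Rightarrow> real) \<Rightarrow> (real \<Rightarrow> real) \<Rightarrow> (real \<Rightarrow> real) \<Rightarrow> (real \<Rightarrow> real) \<Rightarrow> (real \<Rightarrow> real)
   \<Rightarrow> real \<Rightarrow> (real \<Rightarrow> real) \<Rightarrow> bool" where
  "is_positive_solution \<phi> c d h f lam u \<longleftrightarrow>
     is_solution \<phi> c d h f lam u \<and> (\<forall>t\<in>{0<..<1}. u t > 0)"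

definition sup_norm01 :: "(real \<Rightarrow> real) \<Rightarrow> real" where
  "sup_norm01 u = (SUP t\<in>{0..1}. \<bar>u t\<bar>)"

end

theory Submission
  imports Defs "HOL-Complex_Analysis.Great_Picard"
begin

text \<open>
  A positive solution increases up to a point \<open>\<sigma>\<close> where its flux \<open>w = d \<phi>(c u')\<close> vanishes and decreases
  afterwards, so one can shoot from the peak: prescribe \<open>\<sigma>\<close> and the height \<open>r = u(\<sigma>)\<close>, integrate
  \<open>u' = \<phi>\<inverse>(w/d)/c\<close>, \<open>w' = -\<lambda> h f(u)\<close> in both directions, and look for \<open>u(0) = u(1) = 0\<close>.  Since
  \<open>f\<close> and \<open>\<phi>\<inverse>\<close> are merely continuous, the argument of \<open>f(u)\<close> is delayed towards \<open>\<sigma>\<close> and \<open>h\<close> is cut off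
  near the end points; the shooting map is then well defined and continuous in \<open>(\<sigma>, r)\<close>.

  If \<open>f/\<phi>\<close> is small up to height \<open>r\<close>, then \<open>u(0) = u(1)\<close> forces both values to be positive; if
  \<open>f/\<phi>\<close> is large on \<open>[\<theta> r, r]\<close>, it forces both to be negative.  Brouwer's theorem on a rectangle in
  the \<open>(\<sigma>, r)\<close>-plane gives a common zero.  These estimates do not depend on the regularisation, so
  Arzela-Ascoli produces a genuine solution.  The height of every solution so obtained lies where
  neither estimate applies, which yields the limits of the norms.
\<close>

section \<open>Calculus and the delayed initial value problem\<close>

text \<open>\<open>h\<close> may fail to be integrable near 0 and 1, so the flux can be unbounded
  there. The integrability condition controls only \<open>P1 \<bar>H t\<bar>\<close>, where
  \<open>H\<close> is the primitive of \<open>h\<close> vanishing at 1/2. The fall of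
  \<open>u\<close> from its peak and the common modulus of continuity are therefore measured by a
  primitive \<Gamma> of that function, which is continuous up to the ends. With variable
  \<open>c\<close> and \<open>d\<close> the profile \<open>u\<close> need not be concave. Its flux
  is still monotone; bounds on the weights and condition (A) then keep \<open>u\<close> above
  \<theta> times its peak on [\<rho>,1-\<rho>] whenever both end values are nonnegative. The bound
  on the fall sees only the end point in the half containing \<sigma>. Equality of the end values
  transfers the conclusion to the other end, and this is all that the fixed point argument asks for
  on the bottom and top sides of the rectangle. At a common zero neither sphere condition can hold.
  Negating them yields two points \<open>x\<close>, \<open>y\<close> with non-strict inequalities,
  which survive the passage to the limit, unlike statements about the approximate peak
  alone.\<close>

lemma deriv_le_imp_diff_le:
  fixes f g :: "real \<Rightarrow> real"
  assumes "a \<le> b" "continuous_on {a..b} f" "continuous_on {a..b} g"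
    and "\<And>x. a < x \<Longrightarrow> x < b \<Longrightarrow> (f has_real_derivative f' x) (at x)"
    and "\<And>x. a < x \<Longrightarrow> x < b \<Longrightarrow> (g has_real_derivative g' x) (at x)"
    and "\<And>x. a < x \<Longrightarrow> x < b \<Longrightarrow> f' x \<le> g' x"
  shows "f b - f a \<le> g b - g a"
proof -
  have "g a - f a \<le> g b - f b"
  proof (rule DERIV_nonneg_imp_increasing_open[OF assms(1), of "\<lambda>x. g x - f x"])
    fix x assume "a < x" "x < b"
    then show "\<exists>y. ((\<lambda>x. g x - f x) has_real_derivative y) (at x) \<and> 0 \<le> y"
      using assms(4-6)[of x] by (intro exI[of _ "g' x - f' x"]) (auto intro!: derivative_intros)
  qed (use assms in \<open>auto intro!: continuous_intros\<close>)
  then show ?thesis by simp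
qed

lemma deriv_le_imp_diff_le_closed:
  fixes f g :: "real \<Rightarrow> real"
  assumes "a \<le> b"
    and f: "\<And>x. a \<le> x \<Longrightarrow> x \<le> b \<Longrightarrow> (f has_real_derivative f' x) (at x)"
    and g: "\<And>x. a \<le> x \<Longrightarrow> x \<le> b \<Longrightarrow> (g has_real_derivative g' x) (at x)"
    and "\<And>x. a \<le> x \<Longrightarrow> x \<le> b \<Longrightarrow> f' x \<le> g' x"
  shows "f b - f a \<le> g b - g a"
proof (rule deriv_le_imp_diff_le[of a b f g f' g'])
  show "continuous_on {a..b} f" "continuous_on {a..b} g"
    using f g by (meson DERIV_atLeastAtMost_imp_continuous_on)+
qed (use assms in auto)

text \<open>Neither \<open>h\<close> nor the limiting source term need be integrable up to the end
  points, so a primitive is asked for on the open interval only, without a prescribed base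
  point.\<close>

lemma open_interval_antiderivative:
  fixes f :: "real \<Rightarrow> real"
  assumes "a < b" "continuous_on {a<..<b} f"
  obtains F where "\<And>x. a < x \<Longrightarrow> x < b \<Longrightarrow> (F has_real_derivative f x) (at x)"
proof -
  have "isCont f x" if "ereal a < ereal x" "ereal x < ereal b" for x
    using assms(2) that by (simp add: continuous_on_eq_continuous_at)
  then have "\<exists>F. \<forall>x. ereal a < ereal x \<longrightarrow> ereal x < ereal b \<longrightarrow> (F has_vector_derivative f x) (at x)"
    by (intro einterval_antiderivative) (use assms in auto)
  then show thesis
    using that by (auto simp: has_real_derivative_iff_has_vector_derivative)
qed

lemma antiderivative_UNIV:
  fixes f :: "real \<Rightarrow> real"
  assumes "continuous_on UNIV f"
  obtains F where "\<And>x. (F has_real_derivative f x) (at x)"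
proof -
  have "isCont f x" for x
    using assms by (simp add: continuous_on_eq_continuous_at)
  then have "\<exists>F. \<forall>x. (-\<infinity>::ereal) < ereal x \<longrightarrow> ereal x < \<infinity> \<longrightarrow> (F has_vector_derivative f x) (at x)"
    by (intro einterval_antiderivative) auto
  then show thesis
    using that by (auto simp: has_real_derivative_iff_has_vector_derivative)
qed

text \<open>Oriented integral from \<open>a\<close> to \<open>b\<close>, scaled to a fixed domain so that joint continuity in
  the endpoints and in parameters is immediate.\<close>
definition oint :: "(real \<Rightarrow> real) \<Rightarrow> real \<Rightarrow> real \<Rightarrow> real" where
  "oint g a b = (b - a) * integral (cbox 0 1) (\<lambda>x. g (a + x * (b - a)))"

lemma oint_same [simp]: "oint g a a = 0"
  by (simp add: oint_def)

lemma oint_eq_diff: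
  assumes g: "continuous_on UNIV g" and F: "\<And>x. (F has_real_derivative g x) (at x)"
  shows "oint g a b = F b - F a"
proof -
  have "((\<lambda>x. (b - a) * g (a + x * (b - a))) has_integral F (a + 1 * (b - a)) - F (a + 0 * (b - a))) {0..1}"
  proof (rule fundamental_theorem_of_calculus)
    fix x :: real
    have "((\<lambda>x. a + x * (b - a)) has_real_derivative b - a) (at x within {0..1})"
      by (auto intro!: derivative_eq_intros)
    from DERIV_chain2[OF F this]
    show "((\<lambda>x. F (a + x * (b - a))) has_vector_derivative (b - a) * g (a + x * (b - a))) (at x within {0..1})"
      by (simp add: has_real_derivative_iff_has_vector_derivative mult.commute)
  qed simp
  from integral_unique[OF this] show ?thesis
    by (simp add: oint_def)
qed

lemma oint_has_real_derivative:
  assumes g: "continuous_on UNIV g"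
  shows "((\<lambda>t. oint g a t) has_real_derivative g t) (at t)"
proof -
  obtain F where F: "\<And>x. (F has_real_derivative g x) (at x)"
    using antiderivative_UNIV[OF g] by blast
  show ?thesis
    unfolding oint_eq_diff[OF g F] using F by (auto intro!: derivative_eq_intros)
qed

lemma oint_cong:
  assumes "\<And>s. \<bar>s - a\<bar> \<le> \<bar>t - a\<bar> \<Longrightarrow> g s = k s"
  shows "oint g a t = oint k a t"
proof -
  have "integral (cbox 0 1) (\<lambda>x. g (a + x * (t - a))) = integral (cbox 0 1) (\<lambda>x. k (a + x * (t - a)))"
  proof (rule integral_cong)
    fix x :: real assume "x \<in> cbox 0 1"
    then have "\<bar>x\<bar> * \<bar>t - a\<bar> \<le> 1 * \<bar>t - a\<bar>"
      by (intro mult_right_mono) auto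
    then show "g (a + x * (t - a)) = k (a + x * (t - a))"
      by (intro assms) (simp add: abs_mult)
  qed
  then show ?thesis by (simp add: oint_def)
qed

lemma continuous_on_oint:
  fixes g :: "'a::topological_space \<Rightarrow> real \<Rightarrow> real"
  assumes g: "continuous_on UNIV (\<lambda>(x, s). g x s)" and a: "continuous_on UNIV a"
  shows "continuous_on UNIV (\<lambda>(x, t). oint (g x) (a x) t)"
proof -
  have a': "continuous_on S (\<lambda>p. a (q p))" if "continuous_on S q" for q :: "'b::topological_space \<Rightarrow> 'a" and S
    by (rule continuous_on_compose2[OF a that]) auto
  have "continuous_on UNIV (\<lambda>y. integral (cbox 0 1) (\<lambda>x. g (fst y) (a (fst y) + x * (snd y - a (fst y)))))"
  proof (rule integral_continuous_on_param)
    have "continuous_on (UNIV \<times> cbox 0 1)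
        (\<lambda>z. (\<lambda>(x, s). g x s) (fst (fst z), a (fst (fst z)) + snd z * (snd (fst z) - a (fst (fst z)))))"
      by (rule continuous_on_compose2[OF g]) (auto intro!: continuous_intros a')
    then show "continuous_on (UNIV \<times> cbox 0 1)
        (\<lambda>(y, x). g (fst y) (a (fst y) + x * (snd y - a (fst y))))"
      by (simp add: case_prod_unfold)
  qed
  then show ?thesis
    unfolding oint_def case_prod_unfold by (auto intro!: continuous_intros a')
qed

text \<open>The argument is moved towards \<open>\<sigma>\<close> by \<open>\<delta>\<close>.  With this delay in the nonlinearity the initial
  value problem becomes explicitly solvable, with continuous dependence on the data, although
  the equation itself need not have unique solutions.\<close>
definition delay :: "real \<Rightarrow> real \<Rightarrow> real \<Rightarrow> real" where
  "delay \<delta> \<sigma> t = t - max (- \<delta>) (min \<delta> (t - \<sigma>))"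

text \<open>Each application brings the argument closer to \<sigma> by \<delta>, or onto \<sigma>;
  this makes the iteration for the delayed problem terminate.\<close>

lemma delay_dist: "\<delta> \<ge> 0 \<Longrightarrow> \<bar>delay \<delta> \<sigma> t - \<sigma>\<bar> = max 0 (\<bar>t - \<sigma>\<bar> - \<delta>)"
  by (auto simp: delay_def max_def min_def)

lemma delay_bounds:
  assumes "\<delta> \<ge> 0"
  shows "t \<le> \<sigma> \<Longrightarrow> t \<le> delay \<delta> \<sigma> t \<and> delay \<delta> \<sigma> t \<le> \<sigma>"
    and "\<sigma> \<le> t \<Longrightarrow> \<sigma> \<le> delay \<delta> \<sigma> t \<and> delay \<delta> \<sigma> t \<le> t"
  using assms by (auto simp: delay_def max_def min_def)

lemma delay_near: "\<delta> \<ge> 0 \<Longrightarrow> \<bar>delay \<delta> \<sigma> t - t\<bar> \<le> \<delta>"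
  by (auto simp: delay_def max_def min_def)

text \<open>Method of steps. At distance at most \<open>(n + 1) * \<delta>\<close> from \<sigma> the
  Picard map \<open>V\<close> reads its argument only at distance at most
  \<open>n * \<delta>\<close>, so the iterates become stationary on [0,1] after finitely many steps.
  No contraction is involved, and each iterate is jointly continuous in \<sigma>, \<open>r\<close>
  and \<open>t\<close>.\<close>

lemma delayed_ivp:
  fixes G :: "real \<Rightarrow> real \<Rightarrow> real" and k F :: "real \<Rightarrow> real"
  assumes G: "continuous_on UNIV (\<lambda>(t, w). G t w)"
    and k: "continuous_on UNIV k" and F: "continuous_on UNIV F" and \<delta>: "\<delta> > 0"
  obtains u w :: "real \<times> real \<Rightarrow> real \<Rightarrow> real"
  where "continuous_on UNIV (\<lambda>(x, t). u x t)"
    and "\<And>\<sigma> r. u (\<sigma>, r) \<sigma> = r" and "\<And>\<sigma> r. w (\<sigma>, r) \<sigma> = 0"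
    and "\<And>\<sigma> r t. (u (\<sigma>, r) has_real_derivative G t (w (\<sigma>, r) t)) (at t)"
    and "\<And>\<sigma> r t. \<sigma> \<in> {0..1} \<Longrightarrow> t \<in> {0..1} \<Longrightarrow>
           (w (\<sigma>, r) has_real_derivative - (k t * F (u (\<sigma>, r) (delay \<delta> \<sigma> t)))) (at t)"
proof -
  define g where "g v x t = - (k t * F (v x (delay \<delta> (fst x) t)))"
    for v :: "real \<times> real \<Rightarrow> real \<Rightarrow> real" and x t
  define W where "W v x t = oint (g v x) (fst x) t" for v x t
  define V where "V v x t = snd x + oint (\<lambda>s. G s (W v x s)) (fst x) t" for v x t
  define C where "C v \<longleftrightarrow> continuous_on UNIV (\<lambda>(x, t). v x t)"
    for v :: "real \<times> real \<Rightarrow> real \<Rightarrow> real"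
  have Cg: "C (g v)" if "C v" for v
  proof -
    have "continuous_on UNIV (\<lambda>z. (\<lambda>(x, t). v x t) (fst z, delay \<delta> (fst (fst z)) (snd z)))"
      by (rule continuous_on_compose2[OF that[unfolded C_def]])
         (auto simp: delay_def intro!: continuous_intros)
    then have "continuous_on UNIV (\<lambda>z. F (v (fst z) (delay \<delta> (fst (fst z)) (snd z))))"
      by (intro continuous_on_compose2[OF F]) auto
    moreover have "continuous_on UNIV (\<lambda>z::(real\<times>real)\<times>real. k (snd z))"
      by (rule continuous_on_compose2[OF k]) (auto intro!: continuous_intros)
    ultimately show ?thesis
      unfolding C_def g_def case_prod_unfold by (intro continuous_intros)
  qed
  have CW: "C (W v)" if "C v" for v
    unfolding C_def W_def
    by (rule continuous_on_oint) (use Cg[OF that] in \<open>auto simp: C_def intro!: continuous_intros\<close>)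
  have CG: "C (\<lambda>x s. G s (W v x s))" if "C v" for v
  proof -
    have "continuous_on UNIV (\<lambda>z. W v (fst z) (snd z))"
      using CW[OF that] unfolding C_def case_prod_unfold .
    then have "continuous_on UNIV (\<lambda>z. (\<lambda>(t, w). G t w) (snd z, W v (fst z) (snd z)))"
      by (intro continuous_on_compose2[OF G]) (auto intro!: continuous_intros)
    then show ?thesis
      unfolding C_def case_prod_unfold by simp
  qed
  have CV: "C (V v)" if "C v" for v
  proof -
    have "continuous_on UNIV (\<lambda>(x, t). oint (\<lambda>s. G s (W v x s)) (fst x) t)"
      by (rule continuous_on_oint) (use CG[OF that] in \<open>auto simp: C_def intro!: continuous_intros\<close>)
    then show ?thesis
      unfolding C_def V_def case_prod_unfold by (intro continuous_intros)
  qed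
  define v where "v n = (V ^^ n) (\<lambda>x t. snd x)" for n
  have Cv: "C (v n)" for n
  proof (induction n)
    case 0
    show ?case by (auto simp: v_def C_def case_prod_unfold intro!: continuous_intros)
  next
    case (Suc n)
    then show ?case using CV by (simp add: v_def)
  qed
  have v_Suc: "v (Suc n) = V (v n)" for n
    by (simp add: v_def)
  have sect: "continuous_on UNIV (q x)" if "C q" for q x
  proof -
    have "continuous_on UNIV (\<lambda>t. (\<lambda>(x, t). q x t) (x, t))"
      by (rule continuous_on_compose2[OF that[unfolded C_def]]) (auto intro!: continuous_intros)
    then show ?thesis by simp
  qed
  have stab: "v (Suc n) x t = v n x t" if "\<bar>t - fst x\<bar> \<le> n * \<delta>" for n x t
    using that
  proof (induction n arbitrary: t)
    case 0
    then show ?case by (simp add: v_def V_def)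
  next
    case (Suc n)
    have "W (v (Suc n)) x s = W (v n) x s" if s: "\<bar>s - fst x\<bar> \<le> \<bar>t - fst x\<bar>" for s
      unfolding W_def
    proof (rule oint_cong)
      fix r assume r: "\<bar>r - fst x\<bar> \<le> \<bar>s - fst x\<bar>"
      have "\<bar>r - fst x\<bar> - \<delta> \<le> n * \<delta>"
        using r s Suc.prems by (simp add: algebra_simps)
      then have "\<bar>delay \<delta> (fst x) r - fst x\<bar> \<le> n * \<delta>"
        using \<delta> by (simp add: delay_dist)
      then show "g (v (Suc n)) x r = g (v n) x r"
        by (simp add: g_def Suc.IH)
    qed
    then have "V (v (Suc n)) x t = V (v n) x t"
      unfolding V_def by (intro arg_cong2[of _ _ _ _ "(+)"] oint_cong) auto
    then show ?case by (simp add: v_Suc)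
  qed
  \<comment> \<open>For \<sigma> and \<open>t\<close> in [0,1] the distance is at most 1, so all of
    [0,1] lies where \<open>v (Suc n)\<close> and \<open>v n\<close> agree.\<close>
  obtain n :: nat where n: "1 \<le> n * \<delta>"
    using reals_Archimedean3[OF \<delta>] by (meson less_imp_le)
  show thesis
  \<comment> \<open>The flux is computed from \<open>v n\<close>, and \<open>v (Suc n)\<close> from
    that flux, so the equation for \<open>u\<close> holds exactly on the whole line. Only the
    equation for \<open>w\<close> needs the stabilisation, hence its restriction to [0,1].\<close>
  proof (rule that[of "v (Suc n)" "W (v n)"])
    show "continuous_on UNIV (\<lambda>(x, t). v (Suc n) x t)"
      using Cv[of "Suc n"] unfolding C_def .
    show "v (Suc n) (\<sigma>, r) \<sigma> = r" "W (v n) (\<sigma>, r) \<sigma> = 0" for \<sigma> r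
      by (simp_all add: v_Suc V_def W_def)
    show "(v (Suc n) (\<sigma>, r) has_real_derivative G t (W (v n) (\<sigma>, r) t)) (at t)" for \<sigma> r t
    proof -
      have "((\<lambda>t. oint (\<lambda>s. G s (W (v n) (\<sigma>, r) s)) \<sigma> t) has_real_derivative G t (W (v n) (\<sigma>, r) t)) (at t)"
        using sect[OF CG[OF Cv[of n]], of "(\<sigma>, r)"] by (rule oint_has_real_derivative)
      then show ?thesis
        unfolding v_Suc V_def by (auto intro!: derivative_eq_intros)
    qed
    show "(W (v n) (\<sigma>, r) has_real_derivative - (k t * F (v (Suc n) (\<sigma>, r) (delay \<delta> \<sigma> t)))) (at t)"
      if "\<sigma> \<in> {0..1}" "t \<in> {0..1}" for \<sigma> r t
    proof -
      have "((\<lambda>t. oint (g (v n) (\<sigma>, r)) \<sigma> t) has_real_derivative g (v n) (\<sigma>, r) t) (at t)"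
        using sect[OF Cg[OF Cv[of n]], of "(\<sigma>, r)"] by (rule oint_has_real_derivative)
      moreover have "v (Suc n) (\<sigma>, r) (delay \<delta> \<sigma> t) = v n (\<sigma>, r) (delay \<delta> \<sigma> t)"
        using that n \<delta> by (intro stab) (auto simp: delay_dist)
      ultimately show ?thesis
        by (simp add: W_def[abs_def] g_def)
    qed
  qed
qed

text \<open>A fixed point of the clamped map below cannot sit at an end of the \<open>\<sigma>\<close>-range unless \<open>A = B\<close>;
  then the boundary conditions exclude the ends of the \<open>r\<close>-range.\<close>
lemma common_zero_on_rectangle:
  fixes A B :: "real \<times> real \<Rightarrow> real"
  assumes r: "r1 \<le> r2"
    and A: "continuous_on UNIV A" and B: "continuous_on UNIV B"
    and left: "\<And>r. r1 \<le> r \<Longrightarrow> A (0, r) \<ge> B (0, r)"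
    and right: "\<And>r. r1 \<le> r \<Longrightarrow> A (1, r) \<le> B (1, r)"
    and bot: "\<And>\<sigma>. \<sigma> \<in> {0..1} \<Longrightarrow> A (\<sigma>, r1) = B (\<sigma>, r1) \<Longrightarrow> A (\<sigma>, r1) > 0"
    and top: "\<And>\<sigma>. \<sigma> \<in> {0..1} \<Longrightarrow> A (\<sigma>, r2) = B (\<sigma>, r2) \<Longrightarrow> A (\<sigma>, r2) < 0"
  obtains \<sigma> r where "\<sigma> \<in> {0..1}" "r \<in> {r1..r2}" "A (\<sigma>, r) = 0" "B (\<sigma>, r) = 0"
proof -
  define S where "S = {0..1::real} \<times> {r1..r2}"
  define g where "g x = (max 0 (min 1 (fst x + (A x - B x))), max r1 (min r2 (snd x + A x)))" for x
  obtain x where x: "x \<in> S" "g x = x"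
  proof (rule brouwer[of S g])
    show "compact S" "convex S" "S \<noteq> {}"
      using r by (auto simp: S_def intro!: compact_Times convex_Times)
    have "continuous_on UNIV g"
      unfolding g_def by (intro continuous_intros A B)
    then show "continuous_on S g"
      by (rule continuous_on_subset) auto
    show "g \<in> S \<rightarrow> S"
      using r by (auto simp: g_def S_def)
  qed (use that in auto)
  obtain \<sigma> r where xe: "x = (\<sigma>, r)" by fastforce
  have s: "\<sigma> \<in> {0..1}" "r \<in> {r1..r2}" using x xe by (auto simp: S_def)
  have f1: "max 0 (min 1 (\<sigma> + (A (\<sigma>, r) - B (\<sigma>, r)))) = \<sigma>"
    and f2: "max r1 (min r2 (r + A (\<sigma>, r))) = r"
    using x(2) by (simp_all add: g_def xe)
  have AB: "A (\<sigma>, r) = B (\<sigma>, r)"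
    using f1 s left[of r] right[of r] by (cases "\<sigma> = 0"; cases "\<sigma> = 1") (auto simp: max_def min_def split: if_splits)
  have "A (\<sigma>, r) = 0"
    using f2 s AB bot[OF s(1)] top[OF s(1)]
    by (cases "r = r1"; cases "r = r2") (auto simp: max_def min_def split: if_splits)
  then show thesis using that s AB by auto
qed

section \<open>Growth of the inverse nonlinearity and half-interval estimates\<close>

locale phi_laplacian =
  fixes \<phi> \<psi>1 \<psi>2 :: "real \<Rightarrow> real"
  assumes phi: "odd_incr_homeo \<phi>" and condA: "condA \<phi> \<psi>1 \<psi>2"
begin

definition P :: "real \<Rightarrow> real" where "P = inv \<phi>"
definition P1 :: "real \<Rightarrow> real" where "P1 = inv_into {0..} \<psi>1"

lemma phi_strict_mono: "strict_mono \<phi>" and phi_surj: "surj \<phi>" and phi_odd: "\<phi> (- x) = - \<phi> x"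
  and phi_cont: "continuous_on UNIV \<phi>"
  using phi by (auto simp: odd_incr_homeo_def)

lemma phi_less_iff [simp]: "\<phi> x < \<phi> y \<longleftrightarrow> x < y" and phi_le_iff [simp]: "\<phi> x \<le> \<phi> y \<longleftrightarrow> x \<le> y"
  using phi_strict_mono by (simp_all add: strict_mono_less strict_mono_less_eq)

lemma phi_0 [simp]: "\<phi> 0 = 0"
  using phi_odd[of 0] by simp

lemma phi_pos_iff [simp]: "0 < \<phi> x \<longleftrightarrow> 0 < x" and phi_nonneg_iff [simp]: "0 \<le> \<phi> x \<longleftrightarrow> 0 \<le> x"
  using phi_less_iff[of 0 x] phi_le_iff[of 0 x] by simp_all

lemma phi_P [simp]: "\<phi> (P y) = y" and P_phi [simp]: "P (\<phi> x) = x"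
  using phi_surj phi_strict_mono
  by (simp_all add: P_def surj_f_inv_f strict_mono_imp_inj_on)

lemma P_less_iff [simp]: "P x < P y \<longleftrightarrow> x < y" and P_le_iff [simp]: "P x \<le> P y \<longleftrightarrow> x \<le> y"
  using phi_less_iff[of "P x" "P y"] phi_le_iff[of "P x" "P y"] by simp_all

lemma P_minus: "P (- y) = - P y"
  by (metis P_phi phi_P phi_odd)

lemma P_0 [simp]: "P 0 = 0"
  by (metis P_phi phi_0)

lemma P_nonneg_iff [simp]: "0 \<le> P x \<longleftrightarrow> 0 \<le> x" and P_pos_iff [simp]: "0 < P x \<longleftrightarrow> 0 < x"
  using P_le_iff[of 0 x] P_less_iff[of 0 x] by simp_all

lemma P_cont: "continuous_on UNIV P"
proof (rule continuous_onI_mono)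
  have "range P = UNIV"
    by (metis P_phi surjI)
  then show "open (range P)" by simp
qed auto

lemma psi1_strict_mono: "strict_mono_on {0..} \<psi>1" and psi1_image: "\<psi>1 ` {0..} = {0..}"
  and psi2_image: "\<psi>2 ` {0..} = {0..}"
  using condA by (auto simp: condA_def incr_homeo_nonneg_def)

lemma psi1_P1: "y \<ge> 0 \<Longrightarrow> \<psi>1 (P1 y) = y" and P1_nonneg: "y \<ge> 0 \<Longrightarrow> P1 y \<ge> 0"
  using f_inv_into_f[of y \<psi>1 "{0..}"] inv_into_into[of y \<psi>1 "{0..}"] psi1_image
  by (auto simp: P1_def)

lemma P1_psi1: "x \<ge> 0 \<Longrightarrow> P1 (\<psi>1 x) = x"
  unfolding P1_def using psi1_strict_mono
  by (intro inv_into_f_f strict_mono_on_imp_inj_on) auto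

lemma P1_mono: "0 \<le> x \<Longrightarrow> x \<le> y \<Longrightarrow> P1 x \<le> P1 y"
  using strict_mono_onD[OF psi1_strict_mono, of "P1 y" "P1 x"] psi1_P1[of x] psi1_P1[of y]
    P1_nonneg[of x] P1_nonneg[of y] by force

lemma psi1_nonneg: "x \<ge> 0 \<Longrightarrow> \<psi>1 x \<ge> 0" and psi2_nonneg: "x \<ge> 0 \<Longrightarrow> \<psi>2 x \<ge> 0"
  using psi1_image psi2_image by auto

lemma psi1_pos: "x > 0 \<Longrightarrow> \<psi>1 x > 0"
  using strict_mono_onD[OF psi1_strict_mono, of 0 x] psi1_nonneg[of 0] by simp

lemma P1_cont: "continuous_on {0..} P1"
proof -
  \<comment> \<open>Extended by the identity below 0, \<open>P1\<close> becomes a monotone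
    surjection of the line, and such a map is continuous.\<close>
  define g where "g x = (if x < 0 then x else P1 x)" for x
  have "continuous_on UNIV g"
  proof (rule continuous_onI_mono)
    have "y \<in> range g" for y
      by (rule image_eqI[of _ _ "if y < 0 then y else \<psi>1 y"])
         (use psi1_nonneg[of y] in \<open>auto simp: g_def P1_psi1\<close>)
    then have "range g = UNIV" by auto
    then show "open (range g)" by simp
    show "g x \<le> g y" if "x \<le> y" for x y
      using that P1_mono[of x y] P1_nonneg[of y] by (auto simp: g_def)
  qed
  then show ?thesis
    by (rule continuous_on_subset[THEN continuous_on_eq]) (auto simp: g_def)
qed

text \<open>The lower half of condition (A) at \<open>P y\<close> and \<open>P1 z\<close>, read
  through the increasing inverse. A factor leaves \<open>P\<close> at the cost of \<open>P1\<close>,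
  which matches the form of the integrability condition.\<close>

lemma P_mult_le:
  assumes "y \<ge> 0" "z \<ge> 0"
  shows "P (y * z) \<le> P y * P1 z"
proof -
  have "\<phi> (P y) * \<psi>1 (P1 z) \<le> \<phi> (P y * P1 z)"
    using condA assms P1_nonneg by (simp add: condA_def del: phi_P)
  then have "\<phi> (P (y * z)) \<le> \<phi> (P y * P1 z)"
    using assms by (simp add: psi1_P1 del: phi_le_iff)
  then show ?thesis by (simp del: phi_P)
qed

lemma phi_mult_ge: "x \<ge> 0 \<Longrightarrow> y \<ge> 0 \<Longrightarrow> \<phi> x * \<psi>1 y \<le> \<phi> (x * y)"
  and phi_mult_le: "x \<ge> 0 \<Longrightarrow> y \<ge> 0 \<Longrightarrow> \<phi> (x * y) \<le> \<phi> x * \<psi>2 y"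
  using condA by (simp_all add: condA_def)

text \<open>\<open>H\<close> may be unbounded at 0 and 1, but the integrability condition makes
  \<open>P1 \<bar>H t\<bar>\<close> integrable, so its primitive \<Gamma> extends continuously to
  the end points.\<close>

lemma integrated_profile:
  assumes hc: "continuous_on {0<..<1} h" and h0: "\<And>t. t \<in> {0<..<1} \<Longrightarrow> h t \<ge> 0"
    and hint: "h_integrability \<psi>1 h"
  obtains H \<Gamma> where "H (1/2) = 0"
    and "\<And>t. t \<in> {0<..<1} \<Longrightarrow> (H has_real_derivative h t) (at t)"
    and "continuous_on {0..1} \<Gamma>"
    and "\<And>t. t \<in> {0<..<1} \<Longrightarrow> (\<Gamma> has_real_derivative P1 \<bar>H t\<bar>) (at t)"
proof -
  obtain H0 where H0: "\<And>t. 0 < t \<Longrightarrow> t < 1 \<Longrightarrow> (H0 has_real_derivative h t) (at t)"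
    using open_interval_antiderivative[OF zero_less_one hc] by blast
  define H where "H t = H0 t - H0 (1/2)" for t
  have H: "(H has_real_derivative h t) (at t)" if "t \<in> {0<..<1}" for t
    unfolding H_def using DERIV_diff[OF H0[of t] DERIV_const, of "H0 (1/2)"] that by simp
  have Hint: "integral {a..b} h = H b - H a" if "0 < a" "a \<le> b" "b < 1" for a b
  proof (rule integral_unique, rule fundamental_theorem_of_calculus)
    fix x assume "x \<in> {a..b}"
    then have "(H has_real_derivative h x) (at x within {a..b})"
      using that by (intro has_field_derivative_at_within[OF H]) auto
    then show "(H has_vector_derivative h x) (at x within {a..b})"
      by (simp add: has_real_derivative_iff_has_vector_derivative)
  qed (use that in auto)
  have Hm: "H a \<le> H b" if "0 < a" "a \<le> b" "b < 1" for a b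
  proof -
    have "(0::real) - 0 \<le> H b - H a"
      by (rule deriv_le_imp_diff_le_closed[of a b "\<lambda>_. 0" "\<lambda>_. 0" H h], fact, rule DERIV_const, rule H)
         (use that h0 in auto)
    then show ?thesis by simp
  qed
  have Hhalf: "H (1/2) = 0" by (simp add: H_def)
  have Hc: "continuous_on {0<..<1} H"
    by (rule DERIV_continuous_on, rule has_field_derivative_at_within, rule H)
  define k where "k s = P1 \<bar>H s\<bar>" for s
  have kc: "continuous_on {0<..<1} k"
    unfolding k_def by (rule continuous_on_compose2[OF P1_cont]) (auto intro!: continuous_intros Hc)
  have k1: "integral {s..1/2} h = \<bar>H s\<bar>" if "s \<in> {0<..1/2}" for s
  proof -
    have "H s \<le> 0" using Hm[of s "1/2"] that unfolding Hhalf by simp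
    moreover have "integral {s..1/2} h = H (1/2) - H s" by (rule Hint) (use that in auto)
    ultimately show ?thesis unfolding Hhalf by simp
  qed
  have k2: "integral {1/2..s} h = \<bar>H s\<bar>" if "s \<in> {1/2..<1}" for s
  proof -
    have "0 \<le> H s" using Hm[of "1/2" s] that unfolding Hhalf by simp
    moreover have "integral {1/2..s} h = H s - H (1/2)" by (rule Hint) (use that in auto)
    ultimately show ?thesis unfolding Hhalf by simp
  qed
  have meas: "(\<lambda>s. indicator A s *\<^sub>R k s) \<in> borel_measurable borel"
    if "A \<subseteq> {0<..<1}" "A \<in> sets borel" for A
    by (rule borel_measurable_continuous_on_indicator) (use that continuous_on_subset[OF kc] in blast)+
  let ?f1 = "\<lambda>s. ennreal (indicator {0<..1/2} s *\<^sub>R k s)"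
  let ?f2 = "\<lambda>s. ennreal (indicator {1/2..<1} s *\<^sub>R k s)"
  have k0: "k s \<ge> 0" for s by (simp add: k_def P1_nonneg)
  have m: "?f1 \<in> borel_measurable lborel" "?f2 \<in> borel_measurable lborel"
  proof -
    have sub: "{0<..1/2::real} \<subseteq> {0<..<1}" "{1/2..<1::real} \<subseteq> {0<..<1}"
      by auto
    show "?f1 \<in> borel_measurable lborel" "?f2 \<in> borel_measurable lborel"
      using meas[OF sub(1)] meas[OF sub(2)] by simp_all
  qed
  have "(\<integral>\<^sup>+ s. ?f1 s + ?f2 s \<partial>lborel) = (\<integral>\<^sup>+ s. ?f1 s \<partial>lborel) + (\<integral>\<^sup>+ s. ?f2 s \<partial>lborel)"
    by (rule nn_integral_add) (use m in auto)
  also have "(\<integral>\<^sup>+ s. ?f1 s \<partial>lborel)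
      = (\<integral>\<^sup>+ s\<in>{0<..1/2}. ennreal (inv_into {0..} \<psi>1 (integral {s..1/2} h)) \<partial>lborel)"
    by (rule nn_integral_cong) (simp add: k1 k_def P1_def split: split_indicator)
  also have "(\<integral>\<^sup>+ s. ?f2 s \<partial>lborel)
      = (\<integral>\<^sup>+ s\<in>{1/2..<1}. ennreal (inv_into {0..} \<psi>1 (integral {1/2..s} h)) \<partial>lborel)"
    by (rule nn_integral_cong) (simp add: k2 k_def P1_def split: split_indicator)
  finally have fin: "(\<integral>\<^sup>+ s. ?f1 s + ?f2 s \<partial>lborel) < \<infinity>"
    using hint unfolding h_integrability_def by simp
  \<comment> \<open>The two half-intervals cover (0,1), so the sum of the integrands dominates
    \<open>k\<close> there; counting 1/2 twice is harmless for an upper bound.\<close>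
  have "(\<integral>\<^sup>+ s. ennreal (indicator {0<..<1} s *\<^sub>R k s) \<partial>lborel) \<le> (\<integral>\<^sup>+ s. ?f1 s + ?f2 s \<partial>lborel)"
    by (rule nn_integral_mono) (auto split: split_indicator simp: k0)
  then have "set_integrable lborel {0<..<1} k"
    unfolding set_integrable_def
    using fin meas[of "{0<..<1}"] by (intro integrableI_nonneg) (auto simp: k0)
  then have "k integrable_on {0..1}"
    by (simp add: set_borel_integral_eq_integral(1) integrable_on_Icc_iff_Ioo)
  define \<Gamma> where "\<Gamma> t = integral {0..t} k" for t
  have "(\<Gamma> has_real_derivative k t) (at t)" if "t \<in> {0<..<1}" for t
  proof -
    have "continuous (at t within {0..1}) k"
      using kc that by (simp add: continuous_on_eq_continuous_at continuous_at_imp_continuous_at_within)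
    then have "(\<Gamma> has_vector_derivative k t) (at t within {0..1})"
      unfolding \<Gamma>_def using that \<open>k integrable_on {0..1}\<close>
        integral_has_vector_derivative_continuous_at[of k 0 1 t "{}"] by simp
    then show ?thesis
      using that by (simp add: has_real_derivative_iff_has_vector_derivative at_within_Icc_at)
  qed
  moreover have "continuous_on {0..1} \<Gamma>"
    unfolding \<Gamma>_def by (rule indefinite_integral_continuous_1) fact
  ultimately show thesis
    using that[of H \<Gamma>] Hhalf H by (simp add: k_def)
qed

end

section \<open>Slopes in terms of the flux, and estimates to the left of the peak\<close>

locale weighted_phi_laplacian = phi_laplacian +
  fixes c d :: "real \<Rightarrow> real" and c0 c1 d0 d1 :: real
  assumes c0: "0 < c0" and d0: "0 < d0"
    and c_bd: "\<And>t. t \<in> {0..1} \<Longrightarrow> c0 \<le> c t \<and> c t \<le> c1"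
    and d_bd: "\<And>t. t \<in> {0..1} \<Longrightarrow> d0 \<le> d t \<and> d t \<le> d1"
begin

definition G :: "real \<Rightarrow> real \<Rightarrow> real" where "G t w = P (w / d t) / c t"

lemma c1: "0 < c1" and d1: "0 < d1"
  using c_bd[of 0] d_bd[of 0] c0 d0 by auto

text \<open>The bound \<open>w'\<close> has to be nonnegative, because replacing the weights by
  their lower bounds enlarges a quotient only then; \<open>w\<close> itself may be negative.\<close>

lemma G_le:
  assumes "t \<in> {0..1}" "w \<le> w'" "0 \<le> w'"
  shows "G t w \<le> P (w' / d0) / c0"
proof -
  have d: "0 < d t" "d0 \<le> d t" and c: "0 < c t" "c0 \<le> c t"
    using assms(1) c_bd[of t] d_bd[of t] c0 d0 by auto
  have "w / d t \<le> w' / d t" using assms d by (simp add: divide_right_mono)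
  also have "\<dots> \<le> w' / d0" using assms d d0 by (intro divide_left_mono) auto
  finally have "P (w / d t) / c t \<le> P (w' / d0) / c t"
    using c by (intro divide_right_mono) auto
  also have "\<dots> \<le> P (w' / d0) / c0"
    using c c0 d0 assms by (intro divide_left_mono) auto
  finally show ?thesis by (simp add: G_def)
qed

lemma G_ge:
  assumes "t \<in> {0..1}" "w' \<le> w" "0 \<le> w'"
  shows "P (w' / d1) / c1 \<le> G t w"
proof -
  have d: "0 < d t" "d t \<le> d1" and c: "0 < c t" "c t \<le> c1"
    using assms(1) c_bd[of t] d_bd[of t] c0 d0 by auto
  have "w' / d1 \<le> w' / d t" using assms d d1 by (intro divide_left_mono) auto
  also have "\<dots> \<le> w / d t" using assms d by (intro divide_right_mono) auto
  finally have "P (w' / d1) / c1 \<le> P (w / d t) / c1"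
    using c1 by (intro divide_right_mono) auto
  also have "\<dots> \<le> P (w / d t) / c t"
    using c d c1 assms by (intro divide_left_mono) auto
  finally show ?thesis by (simp add: G_def)
qed

lemma G_abs_le:
  assumes "t \<in> {0..1}" "\<bar>w\<bar> \<le> w'"
  shows "\<bar>G t w\<bar> \<le> P (w' / d0) / c0"
proof -
  have "G t (- w) = - G t w"
    using P_minus[of "w / d t"] by (simp add: G_def)
  moreover have "0 \<le> w'" "w \<le> w'" "- w \<le> w'" using assms(2) by auto
  ultimately show ?thesis
    using G_le[of t w w'] G_le[of t "- w" w'] assms(1) by auto
qed

text \<open>By \<open>P_mult_le\<close>, the largest slope \<open>P (w / d0) / c0\<close> compatible
  with a flux \<open>w \<ge> 0\<close> is at most \<open>hump\<close> times the smallest one,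
  \<open>P (w / d1) / c1\<close>.\<close>

definition hump :: real where "hump = c1 / c0 * P1 (d1 / d0)"

lemma hump_nonneg: "hump \<ge> 0"
  using c0 c1 d0 d1 by (simp add: hump_def P1_nonneg)

lemma left_drop_le:
  assumes \<sigma>: "\<sigma> \<in> {0..1/2}" and \<Lambda>: "\<Lambda> \<ge> 0"
    and u: "continuous_on {0..\<sigma>} u"
      "\<And>t. 0 < t \<Longrightarrow> t < \<sigma> \<Longrightarrow> (u has_real_derivative G t (w t)) (at t)"
    and w: "\<And>t. 0 < t \<Longrightarrow> t \<le> \<sigma> \<Longrightarrow> (w has_real_derivative - w' t) (at t)"
      "\<And>t. 0 < t \<Longrightarrow> t \<le> \<sigma> \<Longrightarrow> w' t \<le> \<Lambda> * h t" "w \<sigma> = 0"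
    and h: "\<And>t. t \<in> {0<..<1} \<Longrightarrow> h t \<ge> 0"
    and H: "H (1/2) = 0" "\<And>t. t \<in> {0<..<1} \<Longrightarrow> (H has_real_derivative h t) (at t)"
    and \<Gamma>: "continuous_on {0..1} \<Gamma>"
      "\<And>t. t \<in> {0<..<1} \<Longrightarrow> (\<Gamma> has_real_derivative P1 \<bar>H t\<bar>) (at t)"
  shows "u \<sigma> - u 0 \<le> P (\<Lambda> / d0) / c0 * (\<Gamma> \<sigma> - \<Gamma> 0)"
proof -
  have Hm: "H a \<le> H b" if "0 < a" "a \<le> b" "b < 1" for a b
  proof -
    have "(0::real) - 0 \<le> H b - H a"
      by (rule deriv_le_imp_diff_le_closed[of a b "\<lambda>_. 0" "\<lambda>_. 0" H h], fact, rule DERIV_const, rule H)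
         (use that h in auto)
    then show ?thesis by simp
  qed
  have "u \<sigma> - u 0 \<le> P (\<Lambda> / d0) / c0 * \<Gamma> \<sigma> - P (\<Lambda> / d0) / c0 * \<Gamma> 0"
  proof (rule deriv_le_imp_diff_le[of 0 \<sigma> u _ "\<lambda>t. G t (w t)" "\<lambda>t. P (\<Lambda> / d0) / c0 * P1 \<bar>H t\<bar>"])
    show "continuous_on {0..\<sigma>} (\<lambda>t. P (\<Lambda> / d0) / c0 * \<Gamma> t)"
      by (intro continuous_intros continuous_on_subset[OF \<Gamma>(1)]) (use \<sigma> in auto)
    fix t assume t: "0 < t" "t < \<sigma>"
    then have t1: "t \<in> {0<..<1}" using \<sigma> by auto
    show "((\<lambda>t. P (\<Lambda> / d0) / c0 * \<Gamma> t) has_real_derivative P (\<Lambda> / d0) / c0 * P1 \<bar>H t\<bar>) (at t)"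
      by (rule DERIV_cmult[OF \<Gamma>(2)[OF t1]])
    have dw: "((\<lambda>s. - w s) has_real_derivative w' x) (at x)" if "0 < x" "x \<le> \<sigma>" for x
      using DERIV_minus[OF w(1)[OF that]] by simp
    have dH: "((\<lambda>s. \<Lambda> * H s) has_real_derivative \<Lambda> * h x) (at x)" if "0 < x" "x \<le> \<sigma>" for x
      by (rule DERIV_cmult[OF H(2)]) (use that \<sigma> in auto)
    have "- w \<sigma> - - w t \<le> \<Lambda> * H \<sigma> - \<Lambda> * H t"
      by (rule deriv_le_imp_diff_le_closed[of t \<sigma> "\<lambda>s. - w s" w' "\<lambda>s. \<Lambda> * H s" "\<lambda>s. \<Lambda> * h s"])
         (use t w(2) dw dH in \<open>simp_all\<close>)
    also have "\<dots> \<le> \<Lambda> * \<bar>H t\<bar>"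
    proof -
      have "\<Lambda> * H \<sigma> \<le> \<Lambda> * 0"
        using Hm[of \<sigma> "1/2"] \<sigma> t H(1) \<Lambda> by (intro mult_left_mono) auto
      moreover have "\<Lambda> * - H t \<le> \<Lambda> * \<bar>H t\<bar>"
        using \<Lambda> by (intro mult_left_mono) auto
      ultimately show ?thesis by simp
    qed
    finally have "w t \<le> \<Lambda> * \<bar>H t\<bar>" using w(3) by simp
    then have "G t (w t) \<le> P ((\<Lambda> * \<bar>H t\<bar>) / d0) / c0"
      using t1 \<Lambda> by (intro G_le) auto
    also have "\<dots> = P ((\<Lambda> / d0) * \<bar>H t\<bar>) / c0"
      by simp
    also have "\<dots> \<le> P (\<Lambda> / d0) * P1 \<bar>H t\<bar> / c0"
      using \<Lambda> d0 c0 by (intro divide_right_mono P_mult_le) auto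
    finally show "G t (w t) \<le> P (\<Lambda> / d0) / c0 * P1 \<bar>H t\<bar>" by simp
  qed (use u \<sigma> in auto)
  then show ?thesis by (simp add: right_diff_distrib)
qed

text \<open>Substitute for concavity. The flux decreases, so slopes before \<open>t\<close> are at
  least \<open>a\<close> and slopes after \<open>t\<close> at most \<open>hump * a\<close>. Since
  \<open>u 0 \<ge> 0\<close>, the former gives \<open>a * t \<le> u t\<close>, and the rise after
  \<open>t\<close> is then at most \<open>hump * (u t / t)\<close>.\<close>

lemma left_hump:
  assumes t: "0 < t" "t \<le> \<sigma>" "\<sigma> \<le> 1"
    and u: "continuous_on {0..\<sigma>} u" "u 0 \<ge> 0"
      "\<And>s. 0 < s \<Longrightarrow> s < \<sigma> \<Longrightarrow> (u has_real_derivative G s (w s)) (at s)"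
    and w: "\<And>s s'. 0 < s \<Longrightarrow> s \<le> s' \<Longrightarrow> s' \<le> \<sigma> \<Longrightarrow> w s' \<le> w s" "w \<sigma> = 0"
  shows "u \<sigma> \<le> u t * (1 + hump / t)"
proof -
  define a where "a = P (w t / d1) / c1"
  have wt: "0 \<le> w t" using w(1)[of t \<sigma>] w(2) t by simp
  have a0: "a \<ge> 0" using wt c1 d1 by (simp add: a_def)
  have "a * t - a * 0 \<le> u t - u 0"
  proof (rule deriv_le_imp_diff_le[of 0 t "\<lambda>s. a * s" u "\<lambda>_. a" "\<lambda>t. G t (w t)"])
    show "continuous_on {0..t} u"
      by (rule continuous_on_subset[OF u(1)]) (use t in auto)
    show "a \<le> G s (w s)" if "0 < s" "s < t" for s
      unfolding a_def using that t wt w(1)[of s t] by (intro G_ge) auto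
  qed (use t u DERIV_cmult_Id in \<open>auto intro!: continuous_intros\<close>)
  then have 1: "a * t \<le> u t" using u(2) by simp
  have up: "P (w t / d0) / c0 \<le> hump * a"
  proof -
    have "P (w t / d0) = P ((w t / d1) * (d1 / d0))" using d1 by simp
    also have "\<dots> \<le> P (w t / d1) * P1 (d1 / d0)"
      using wt d0 d1 by (intro P_mult_le) auto
    finally have "P (w t / d0) / c0 \<le> P (w t / d1) * P1 (d1 / d0) / c0"
      using c0 by (intro divide_right_mono) auto
    also have "\<dots> = hump * a" using c1 by (simp add: hump_def a_def)
    finally show ?thesis .
  qed
  have "u \<sigma> - u t \<le> hump * a * \<sigma> - hump * a * t"
  proof (rule deriv_le_imp_diff_le[of t \<sigma> u "\<lambda>s. hump * a * s" "\<lambda>s. G s (w s)" "\<lambda>_. hump * a"])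
    show "continuous_on {t..\<sigma>} u"
      by (rule continuous_on_subset[OF u(1)]) (use t in auto)
    show "G s (w s) \<le> hump * a" if "t < s" "s < \<sigma>" for s
      using G_le[of s "w s" "w t"] that t wt w(1)[of t s] up by simp
  qed (use t u DERIV_cmult_Id in \<open>auto intro!: continuous_intros\<close>)
  also have "\<dots> = hump * a * (\<sigma> - t)" by (simp add: right_diff_distrib)
  also have "\<dots> \<le> hump * a * 1"
    using t hump_nonneg a0 by (intro mult_left_mono) auto
  also have "\<dots> \<le> hump * (u t / t)"
    using mult_right_mono[OF 1 hump_nonneg] t by (simp add: field_simps)
  finally show ?thesis by (simp add: algebra_simps)
qed

text \<open>The source on [a,m] accumulates a flux of at least \<open>(m - a) * K\<close> at
  \<open>a\<close>, because the flux at \<open>m\<close> is still nonnegative. On (0,a) the flux is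
  no smaller, which forces the rise there.\<close>

lemma left_rise_ge:
  assumes a: "0 < a" "a < m" "m \<le> \<sigma>" "\<sigma> \<le> 1" and K: "K \<ge> 0"
    and u: "continuous_on {0..\<sigma>} u"
      "\<And>s. 0 < s \<Longrightarrow> s < \<sigma> \<Longrightarrow> (u has_real_derivative G s (w s)) (at s)"
    and w: "\<And>s s'. 0 < s \<Longrightarrow> s \<le> s' \<Longrightarrow> s' \<le> \<sigma> \<Longrightarrow> w s' \<le> w s" "w \<sigma> = 0"
    and w': "\<And>t. a \<le> t \<Longrightarrow> t \<le> m \<Longrightarrow> (w has_real_derivative - w' t) (at t)"
      "\<And>t. a \<le> t \<Longrightarrow> t \<le> m \<Longrightarrow> K \<le> w' t"
  shows "a * (P ((m - a) * K / d1) / c1) \<le> u a - u 0"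
proof -
  have dw: "((\<lambda>s. - w s) has_real_derivative w' x) (at x)" if "a \<le> x" "x \<le> m" for x
    using DERIV_minus[OF w'(1)[OF that]] by simp
  have "K * m - K * a \<le> - w m - - w a"
    by (rule deriv_le_imp_diff_le_closed[of a m "\<lambda>s. K * s" "\<lambda>_. K" "\<lambda>s. - w s" w'])
       (use a w'(2) dw in \<open>simp_all add: DERIV_cmult_Id\<close>)
  moreover have "w m \<ge> 0" using w(1)[of m \<sigma>] w(2) a by simp
  ultimately have wa: "(m - a) * K \<le> w a" by (simp add: algebra_simps)
  define b where "b = P ((m - a) * K / d1) / c1"
  have "b * a - b * 0 \<le> u a - u 0"
  proof (rule deriv_le_imp_diff_le[of 0 a "\<lambda>s. b * s" u "\<lambda>_. b" "\<lambda>t. G t (w t)"])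
    show "continuous_on {0..a} u"
      by (rule continuous_on_subset[OF u(1)]) (use a in auto)
    show "b \<le> G s (w s)" if "0 < s" "s < a" for s
      unfolding b_def using that a wa w(1)[of s a] K by (intro G_ge) auto
  qed (use a u DERIV_cmult_Id in \<open>auto intro!: continuous_intros\<close>)
  then show ?thesis by (simp add: b_def mult.commute)
qed

section \<open>The peak system and its a priori estimates\<close>

lemma G_minus: "G t (- w) = - G t w"
  using P_minus[of "w / d t"] by (simp add: G_def)

text \<open>\<open>u\<close> peaks at \<open>\<sigma>\<close>, where the flux \<open>w = d \<phi>(c u')\<close> vanishes; \<open>p\<close> is a delay towards \<open>\<sigma>\<close>.\<close>
definition peak_system ::
  "(real \<Rightarrow> real) \<Rightarrow> (real \<Rightarrow> real) \<Rightarrow> (real \<Rightarrow> real) \<Rightarrow> real \<Rightarrow> (real \<Rightarrow> real) \<Rightarrow> (real \<Rightarrow> real) \<Rightarrow> bool" where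
  "peak_system k F p \<sigma> u w \<longleftrightarrow>
     \<sigma> \<in> {0..1} \<and> w \<sigma> = 0 \<and> (\<forall>x. 0 \<le> F x) \<and> (\<forall>t\<in>{0..1}. 0 \<le> k t) \<and>
     (\<forall>t\<in>{0..1}. (t \<le> \<sigma> \<longrightarrow> t \<le> p t \<and> p t \<le> \<sigma>) \<and> (\<sigma> \<le> t \<longrightarrow> \<sigma> \<le> p t \<and> p t \<le> t)) \<and>
     (\<forall>t\<in>{0..1}. (u has_real_derivative G t (w t)) (at t)) \<and>
     (\<forall>t\<in>{0..1}. (w has_real_derivative - (k t * F (u (p t)))) (at t))"

lemma reflect_locale:
  "weighted_phi_laplacian \<phi> \<psi>1 \<psi>2 (\<lambda>t. c (1 - t)) (\<lambda>t. d (1 - t)) c0 c1 d0 d1"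
  by unfold_locales (use c0 d0 c_bd d_bd in auto)

lemma DERIV_reflect:
  assumes "(g has_real_derivative D) (at (1 - t))"
  shows "((\<lambda>t. g (1 - t)) has_real_derivative - D) (at t)"
proof -
  have "((\<lambda>t. 1 - t) has_real_derivative -1) (at t)"
    by (auto intro!: derivative_eq_intros)
  from DERIV_chain2[OF assms this] show ?thesis by simp
qed

text \<open>Reflection reverses the sign of \<open>u'\<close> and of the flux, which the oddness of
  \<phi> makes compatible with \<open>G\<close>. Estimates to the left of the peak thereby yield
  those to the right, for the reflected weights.\<close>

lemma peak_system_reflect:
  assumes "peak_system k F p \<sigma> u w"
  shows "weighted_phi_laplacian.peak_system \<phi> (\<lambda>t. c (1 - t)) (\<lambda>t. d (1 - t))
    (\<lambda>t. k (1 - t)) F (\<lambda>t. 1 - p (1 - t)) (1 - \<sigma>) (\<lambda>t. u (1 - t)) (\<lambda>t. - w (1 - t))"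
proof -
  interpret r: weighted_phi_laplacian \<phi> \<psi>1 \<psi>2 "\<lambda>t. c (1 - t)" "\<lambda>t. d (1 - t)" c0 c1 d0 d1
    by (rule reflect_locale)
  have rG: "r.G t w = G (1 - t) w" for t w by (simp add: r.G_def G_def)
  have 1: "((\<lambda>t. u (1 - t)) has_real_derivative r.G t (- w (1 - t))) (at t)" if "t \<in> {0..1}" for t
    unfolding rG G_minus
    by (rule DERIV_reflect) (use assms that in \<open>auto simp: peak_system_def\<close>)
  have 2: "((\<lambda>t. - w (1 - t)) has_real_derivative - (k (1 - t) * F (u (1 - (1 - p (1 - t)))))) (at t)"
    if "t \<in> {0..1}" for t
  proof -
    have "(w has_real_derivative - (k (1 - t) * F (u (p (1 - t))))) (at (1 - t))"
      using assms that by (auto simp: peak_system_def)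
    from DERIV_minus[OF DERIV_reflect[OF this]] show ?thesis by simp
  qed
  have 3: "(t \<le> 1 - \<sigma> \<longrightarrow> t \<le> 1 - p (1 - t) \<and> 1 - p (1 - t) \<le> 1 - \<sigma>) \<and>
        (1 - \<sigma> \<le> t \<longrightarrow> 1 - \<sigma> \<le> 1 - p (1 - t) \<and> 1 - p (1 - t) \<le> t)" if "t \<in> {0..1}" for t
  proof -
    have "1 - t \<in> {0..1}" using that by auto
    then have "(1 - t \<le> \<sigma> \<longrightarrow> 1 - t \<le> p (1 - t) \<and> p (1 - t) \<le> \<sigma>) \<and> (\<sigma> \<le> 1 - t \<longrightarrow> \<sigma> \<le> p (1 - t) \<and> p (1 - t) \<le> 1 - t)"
      using assms unfolding peak_system_def by blast
    then show ?thesis by linarith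
  qed
  show ?thesis
    unfolding r.peak_system_def
    using assms 1 2 3 by (auto simp: peak_system_def)
qed

context
  fixes k F p \<sigma> u w
  assumes sys: "peak_system k F p \<sigma> u w"
begin

lemma sys_\<sigma>: "0 \<le> \<sigma>" "\<sigma> \<le> 1" and sys_w\<sigma>: "w \<sigma> = 0"
  using sys by (auto simp: peak_system_def)

lemma sys_du: "t \<in> {0..1} \<Longrightarrow> (u has_real_derivative G t (w t)) (at t)"
  and sys_dw: "t \<in> {0..1} \<Longrightarrow> (w has_real_derivative - (k t * F (u (p t)))) (at t)"
  and sys_source_nonneg: "t \<in> {0..1} \<Longrightarrow> 0 \<le> k t * F (u (p t))"
  using sys by (auto simp: peak_system_def)

lemma sys_cont: "continuous_on {0..1} u"
  by (rule DERIV_continuous_on, rule has_field_derivative_at_within, rule sys_du)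

lemma sys_w_antimono:
  assumes "0 \<le> s" "s \<le> s'" "s' \<le> 1"
  shows "w s' \<le> w s"
proof -
  have "w s' - w s \<le> 0 - 0"
    by (rule deriv_le_imp_diff_le_closed[of s s' w "\<lambda>t. - (k t * F (u (p t)))" "\<lambda>_. 0" "\<lambda>_. 0"],
        fact, rule sys_dw)
       (use assms sys_source_nonneg in auto)
  then show ?thesis by simp
qed

lemma sys_u_mono_left:
  assumes "0 \<le> s" "s \<le> s'" "s' \<le> \<sigma>"
  shows "u s \<le> u s'"
proof -
  have G: "0 \<le> G t (w t)" if "s \<le> t" "t \<le> s'" for t
    using G_ge[of t 0 "w t"] sys_w_antimono[of t \<sigma>] that assms sys_\<sigma> sys_w\<sigma> by simp
  have "(0::real) - 0 \<le> u s' - u s"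
    by (rule deriv_le_imp_diff_le_closed[of s s' "\<lambda>_. 0" "\<lambda>_. 0" u "\<lambda>t. G t (w t)"],
        fact, rule DERIV_const, rule sys_du)
       (use assms sys_\<sigma> G in auto)
  then show ?thesis by simp
qed

lemma sys_drop_left:
  assumes \<sigma>: "\<sigma> \<le> 1/2" and \<Lambda>: "\<Lambda> \<ge> 0"
    and kF: "\<And>t. t \<in> {0<..<1} \<Longrightarrow> k t * F (u (p t)) \<le> \<Lambda> * h t"
    and h: "\<And>t. t \<in> {0<..<1} \<Longrightarrow> h t \<ge> 0"
    and H: "H (1/2) = 0" "\<And>t. t \<in> {0<..<1} \<Longrightarrow> (H has_real_derivative h t) (at t)"
    and \<Gamma>: "continuous_on {0..1} \<Gamma>"
      "\<And>t. t \<in> {0<..<1} \<Longrightarrow> (\<Gamma> has_real_derivative P1 \<bar>H t\<bar>) (at t)"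
  shows "u \<sigma> - u 0 \<le> P (\<Lambda> / d0) / c0 * (\<Gamma> \<sigma> - \<Gamma> 0)"
proof (rule left_drop_le[of \<sigma> \<Lambda> u w "\<lambda>t. k t * F (u (p t))" h H \<Gamma>])
  show "continuous_on {0..\<sigma>} u"
    by (rule continuous_on_subset[OF sys_cont]) (use sys_\<sigma> in auto)
qed (use assms sys_\<sigma> sys_w\<sigma> sys_du sys_dw in auto)

lemma sys_hump_left:
  assumes "0 < t" "t \<le> \<sigma>" "u 0 \<ge> 0"
  shows "u \<sigma> \<le> u t * (1 + hump / t)"
proof (rule left_hump[of t \<sigma> u w])
  show "continuous_on {0..\<sigma>} u"
    by (rule continuous_on_subset[OF sys_cont]) (use sys_\<sigma> in auto)
qed (use assms sys_\<sigma> sys_w\<sigma> sys_du sys_w_antimono in auto)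

lemma sys_rise_left:
  assumes a: "0 < a" "a < m" "m \<le> \<sigma>" and K: "K \<ge> 0"
    and kF: "\<And>t. a \<le> t \<Longrightarrow> t \<le> m \<Longrightarrow> K \<le> k t * F (u (p t))"
  shows "a * (P ((m - a) * K / d1) / c1) \<le> u a - u 0"
proof (rule left_rise_ge[of a m \<sigma> K u w "\<lambda>t. k t * F (u (p t))"])
  show "continuous_on {0..\<sigma>} u"
    by (rule continuous_on_subset[OF sys_cont]) (use sys_\<sigma> in auto)
qed (use assms sys_\<sigma> sys_w\<sigma> sys_du sys_dw sys_w_antimono in auto)

end

context
  fixes k F p \<sigma> u w
  assumes sys: "peak_system k F p \<sigma> u w"
begin

interpretation r: weighted_phi_laplacian \<phi> \<psi>1 \<psi>2 "\<lambda>t. c (1 - t)" "\<lambda>t. d (1 - t)" c0 c1 d0 d1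
  by (rule reflect_locale)

lemmas refl_sys = peak_system_reflect[OF sys]

lemma sys_u_mono_right:
  assumes "\<sigma> \<le> s" "s \<le> s'" "s' \<le> 1"
  shows "u s' \<le> u s"
  using r.sys_u_mono_left[OF refl_sys, of "1 - s'" "1 - s"] assms by simp

lemma sys_u_le:
  assumes "t \<in> {0..1}"
  shows "u t \<le> u \<sigma>"
  using sys_u_mono_left[OF sys, of t \<sigma>] sys_u_mono_right[of \<sigma> t] assms sys_\<sigma>[OF sys]
  by (cases "t \<le> \<sigma>") auto

text \<open>A delay towards the peak can only increase \<open>u\<close>, so lower bounds on
  \<open>u t\<close> survive in the argument of the nonlinearity; the upper bound is the peak value
  anyway.\<close>

lemma sys_u_delay_ge:
  assumes "t \<in> {0..1}"
  shows "u t \<le> u (p t)" "p t \<in> {0..1}"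
proof -
  have p: "(t \<le> \<sigma> \<longrightarrow> t \<le> p t \<and> p t \<le> \<sigma>) \<and> (\<sigma> \<le> t \<longrightarrow> \<sigma> \<le> p t \<and> p t \<le> t)"
    using sys assms by (auto simp: peak_system_def)
  show "u t \<le> u (p t)"
    using sys_u_mono_left[OF sys, of t "p t"] sys_u_mono_right[of "p t" t] assms p
    by (cases "t \<le> \<sigma>") auto
  show "p t \<in> {0..1}"
    using p assms sys_\<sigma>[OF sys] by (cases "t \<le> \<sigma>") auto
qed

lemma sys_u_nonneg:
  assumes "t \<in> {0..1}" "u 0 \<ge> 0" "u 1 \<ge> 0"
  shows "u t \<ge> 0"
  using sys_u_mono_left[OF sys, of 0 t] sys_u_mono_right[of t 1] assms
  by (cases "t \<le> \<sigma>") auto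

lemma sys_drop_right:
  assumes \<sigma>: "1/2 \<le> \<sigma>" and \<Lambda>: "\<Lambda> \<ge> 0"
    and kF: "\<And>t. t \<in> {0<..<1} \<Longrightarrow> k t * F (u (p t)) \<le> \<Lambda> * h t"
    and h: "\<And>t. t \<in> {0<..<1} \<Longrightarrow> h t \<ge> 0"
    and H: "H (1/2) = 0" "\<And>t. t \<in> {0<..<1} \<Longrightarrow> (H has_real_derivative h t) (at t)"
    and \<Gamma>: "continuous_on {0..1} \<Gamma>"
      "\<And>t. t \<in> {0<..<1} \<Longrightarrow> (\<Gamma> has_real_derivative P1 \<bar>H t\<bar>) (at t)"
  shows "u \<sigma> - u 1 \<le> P (\<Lambda> / d0) / c0 * (\<Gamma> 1 - \<Gamma> \<sigma>)"
proof -
  have "u (1 - (1 - \<sigma>)) - u (1 - 0) \<le> P (\<Lambda> / d0) / c0 * (- \<Gamma> (1 - (1 - \<sigma>)) - - \<Gamma> (1 - 0))"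
  \<comment> \<open>Reflection changes the sign of derivatives, so the reflected \<open>h\<close>
    has primitive \<open>- H (1 - t)\<close>, still zero at 1/2; \<Gamma> is treated alike.\<close>
  proof (rule r.sys_drop_left[OF refl_sys, of \<Lambda> "\<lambda>t. h (1 - t)" "\<lambda>t. - H (1 - t)" "\<lambda>t. - \<Gamma> (1 - t)"])
    show "continuous_on {0..1} (\<lambda>t. - \<Gamma> (1 - t))"
      by (intro continuous_intros continuous_on_compose2[OF \<Gamma>(1)]) auto
    show "((\<lambda>t. - H (1 - t)) has_real_derivative h (1 - t)) (at t)" if "t \<in> {0<..<1}" for t
      using DERIV_minus[OF DERIV_reflect[OF H(2)[of "1 - t"]]] that by simp
    show "((\<lambda>t. - \<Gamma> (1 - t)) has_real_derivative P1 \<bar>- H (1 - t)\<bar>) (at t)" if "t \<in> {0<..<1}" for t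
      using DERIV_minus[OF DERIV_reflect[OF \<Gamma>(2)[of "1 - t"]]] that by simp
  qed (use \<sigma> \<Lambda> kF h H(1) in auto)
  then show ?thesis by simp
qed

lemma sys_hump:
  assumes \<rho>: "0 < \<rho>" and t: "\<rho> \<le> t" "t \<le> 1 - \<rho>" and u: "u 0 \<ge> 0" "u 1 \<ge> 0"
  shows "u \<sigma> \<le> u t * (1 + hump / \<rho>)"
proof -
  have ut: "0 \<le> u t" using sys_u_nonneg[of t] t u \<rho> by simp
  have le: "u t * (1 + hump / s) \<le> u t * (1 + hump / \<rho>)" if "\<rho> \<le> s" for s
    using ut that \<rho> hump_nonneg by (intro mult_left_mono add_left_mono divide_left_mono) auto
  show ?thesis
  proof (cases "t \<le> \<sigma>")
    case True
    then show ?thesis using sys_hump_left[OF sys, of t] le[of t] \<rho> t u by simp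
  next
    case False
    then show ?thesis
      using r.sys_hump_left[OF refl_sys, of "1 - t"] le[of "1 - t"] \<rho> t u by simp
  qed
qed

text \<open>Wherever the peak lies, one half of [a,b] is entirely on one side of it: the left half
  if the midpoint is at most \<sigma>, the right half otherwise. Hence the factor
  \<open>(b - a) / 2\<close>.\<close>

lemma sys_rise:
  assumes a: "0 < a" "a < b" "b < 1" and \<rho>: "0 \<le> \<rho>" "\<rho> \<le> a" "\<rho> \<le> 1 - b" and K: "K \<ge> 0"
    and kF: "\<And>t. a \<le> t \<Longrightarrow> t \<le> b \<Longrightarrow> K \<le> k t * F (u (p t))"
    and u: "u 0 \<ge> 0" "u 1 \<ge> 0"
  shows "\<rho> * (P ((b - a) / 2 * K / d1) / c1) \<le> u \<sigma>"
proof -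
  define q where "q = P ((b - a) / 2 * K / d1) / c1"
  have q0: "0 \<le> q" using K a c1 d1 by (simp add: q_def)
  show ?thesis
  proof (cases "(a + b) / 2 \<le> \<sigma>")
    case True
    have e: "(a + b) / 2 - a = (b - a) / 2" by (simp add: field_simps)
    have "a * q \<le> u a - u 0"
      using sys_rise_left[OF sys a(1) _ True K] kF a unfolding e q_def by simp
    then show ?thesis
      using sys_u_le[of a] a u mult_right_mono[OF \<rho>(2) q0] unfolding q_def by simp
  next
    case False
    have e: "1 - (a + b) / 2 - (1 - b) = (b - a) / 2" by (simp add: field_simps)
    have kF': "K \<le> k (1 - t) * F (u (1 - (1 - p (1 - t))))" if "1 - b \<le> t" "t \<le> 1 - (a + b) / 2" for t
    proof -
      have "a \<le> 1 - t" using that(2) a by (simp add: field_simps)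
      then show ?thesis using kF[of "1 - t"] that(1) by simp
    qed
    have "(1 - b) * q \<le> u (1 - (1 - b)) - u (1 - 0)"
      using r.sys_rise_left[OF refl_sys, of "1 - b" "1 - (a + b) / 2" K] kF' False a K unfolding e q_def by simp
    then show ?thesis
      using sys_u_le[of b] a u mult_right_mono[OF \<rho>(3) q0] unfolding q_def by simp
  qed
qed

end

end

section \<open>Peak heights excluded for solutions\<close>

locale sphere_estimates = weighted_phi_laplacian +
  fixes f h H \<Gamma> :: "real \<Rightarrow> real" and a b \<eta> :: real
  assumes f_nonneg: "\<And>s. 0 \<le> s \<Longrightarrow> 0 \<le> f s"
    and f_cont: "continuous_on {0..} f"
    and h_cont: "continuous_on {0<..<1} h"
    and h_nonneg: "\<And>t. t \<in> {0<..<1} \<Longrightarrow> 0 \<le> h t"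
    and H_half: "H (1/2) = 0"
    and H_deriv: "\<And>t. t \<in> {0<..<1} \<Longrightarrow> (H has_real_derivative h t) (at t)"
    and \<Gamma>_cont: "continuous_on {0..1} \<Gamma>"
    and \<Gamma>_deriv: "\<And>t. t \<in> {0<..<1} \<Longrightarrow> (\<Gamma> has_real_derivative P1 \<bar>H t\<bar>) (at t)"
    and ab: "0 < a" "a < b" "b < 1" and \<eta>: "0 < \<eta>" and h_ge: "\<And>t. t \<in> {a..b} \<Longrightarrow> \<eta> \<le> h t"
begin

definition \<rho> :: real where "\<rho> = min a (1 - b)"
text \<open>Reciprocal of the constant in \<open>sys_hump\<close>: with nonnegative end values,
  \<open>\<theta> * u \<sigma> \<le> u t\<close> on [\<rho>,1-\<rho>], which contains [a,b].\<close>

definition \<theta> :: real where "\<theta> = 1 / (1 + hump / \<rho>)"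
text \<open>The extra 1 keeps \<Psi> positive and makes the bound on the fall in
  \<open>no_drop\<close> strict.\<close>

definition \<Psi> :: real where "\<Psi> = \<Gamma> 1 - \<Gamma> 0 + 1"
text \<open>Chosen so that \<open>P (\<kappa>1 * \<phi> r / d0) / c0 \<le> r / \<Psi>\<close> for
  \<open>r > 0\<close>, by the lower half of condition (A).\<close>

definition \<kappa>1 :: real where "\<kappa>1 = d0 * \<psi>1 (c0 / \<Psi>)"
text \<open>Found by reading \<open>sys_rise\<close> backwards: the rise exceeds \<open>r\<close>
  once the accumulated source over \<open>d1\<close> exceeds
  \<open>\<phi> (r * c1 / \<rho>)\<close>, and this is at most
  \<open>\<phi> (\<theta> * r) * \<psi>2 (c1 / (\<rho> * \<theta>))\<close>. The added 1 makes the
  excess strict; the other factors cancel \<open>d1\<close>, \<eta> and the half length of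
  [a,b].\<close>

definition \<kappa>2 :: real where "\<kappa>2 = (\<psi>2 (c1 / (\<rho> * \<theta>)) + 1) * d1 / ((b - a) / 2 * \<eta>)"

text \<open>Shooting trajectories may become negative, where nothing is assumed about
  \<open>f\<close>.\<close>

definition fplus :: "real \<Rightarrow> real" where "fplus x = f (max x 0)"

lemma \<rho>: "0 < \<rho>" "\<rho> \<le> a" "\<rho> \<le> 1 - b"
  using ab by (auto simp: \<rho>_def)

lemma \<theta>: "0 < \<theta>" "\<theta> \<le> 1"
  using hump_nonneg \<rho> by (simp_all add: \<theta>_def add_pos_nonneg)

lemma \<Gamma>_mono: "0 \<le> s \<Longrightarrow> s \<le> t \<Longrightarrow> t \<le> 1 \<Longrightarrow> \<Gamma> s \<le> \<Gamma> t"
proof (rule DERIV_nonneg_imp_increasing_open[of s t \<Gamma>])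
  assume st: "0 \<le> s" "s \<le> t" "t \<le> 1"
  show "continuous_on {s..t} \<Gamma>"
    by (rule continuous_on_subset[OF \<Gamma>_cont]) (use st in auto)
  show "\<exists>y. (\<Gamma> has_real_derivative y) (at x) \<and> 0 \<le> y" if "s < x" "x < t" for x
    using \<Gamma>_deriv[of x] that st P1_nonneg[of "\<bar>H x\<bar>"] by (intro exI[of _ "P1 \<bar>H x\<bar>"]) auto
qed

lemma \<Psi>_pos: "0 < \<Psi>"
  using \<Gamma>_mono[of 0 1] by (simp add: \<Psi>_def)

lemma \<kappa>1_pos: "0 < \<kappa>1"
  using d0 c0 \<Psi>_pos by (simp add: \<kappa>1_def psi1_pos)

lemma \<kappa>2_pos: "0 < \<kappa>2"
  using psi2_nonneg[of "c1 / (\<rho> * \<theta>)"] d1 c1 \<rho> \<theta> ab \<eta> by (simp add: \<kappa>2_def)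

lemma fplus_nonneg: "0 \<le> fplus x"
  by (simp add: fplus_def f_nonneg)

text \<open>If the end values were nonpositive, \<open>u\<close> would fall by at least its height
  between \<sigma> and the end point in the same half of [0,1]. The choice of \<kappa>1 limits that
  fall to the fraction \<open>(\<Psi> - 1) / \<Psi>\<close> of the height.\<close>

lemma no_drop:
  assumes sys: "peak_system k (\<lambda>x. lam * fplus x) p \<sigma> u w"
    and k: "\<And>t. t \<in> {0<..<1} \<Longrightarrow> k t \<le> h t" and lam: "0 < lam" and r: "0 < u \<sigma>"
    and small: "\<And>s. s \<in> {0..u \<sigma>} \<Longrightarrow> lam * f s \<le> \<kappa>1 * \<phi> (u \<sigma>)"
    and eq: "u 0 = u 1"
  shows "0 < u 0"
proof (rule ccontr)
  assume neg: "\<not> 0 < u 0"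
  define \<Lambda> where "\<Lambda> = \<kappa>1 * \<phi> (u \<sigma>)"
  have \<Lambda>: "0 \<le> \<Lambda>" using \<kappa>1_pos r by (simp add: \<Lambda>_def)
  have kF: "k t * (lam * fplus (u (p t))) \<le> \<Lambda> * h t" if t: "t \<in> {0<..<1}" for t
  proof -
    have "p t \<in> {0..1}" using sys_u_delay_ge(2)[OF sys, of t] t by simp
    then have "max (u (p t)) 0 \<in> {0..u \<sigma>}" using sys_u_le[OF sys, of "p t"] r by simp
    then have "lam * fplus (u (p t)) \<le> \<Lambda>" using small unfolding fplus_def \<Lambda>_def by blast
    then have "k t * (lam * fplus (u (p t))) \<le> h t * \<Lambda>"
      using k[OF t] fplus_nonneg[of "u (p t)"] lam h_nonneg[OF t] by (intro mult_mono) auto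
    then show ?thesis by (simp add: mult.commute)
  qed
  have \<sigma>: "0 \<le> \<sigma>" "\<sigma> \<le> 1" using sys_\<sigma>[OF sys] by auto
  have "P (\<Lambda> / d0) = P (\<phi> (u \<sigma>) * \<psi>1 (c0 / \<Psi>))" using d0 by (simp add: \<Lambda>_def \<kappa>1_def mult.commute)
  also have "\<dots> \<le> P (\<phi> (u \<sigma> * (c0 / \<Psi>)))"
    using phi_mult_ge[of "u \<sigma>" "c0 / \<Psi>"] r c0 \<Psi>_pos by (simp del: P_phi)
  also have "\<dots> = u \<sigma> * (c0 / \<Psi>)" by simp
  finally have P: "P (\<Lambda> / d0) / c0 \<le> u \<sigma> / \<Psi>"
    using c0 by (simp add: field_simps)
  have "\<exists>g. u \<sigma> \<le> P (\<Lambda> / d0) / c0 * g \<and> g \<le> \<Psi> - 1"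
  proof (cases "\<sigma> \<le> 1/2")
    case True
    have "u \<sigma> - u 0 \<le> P (\<Lambda> / d0) / c0 * (\<Gamma> \<sigma> - \<Gamma> 0)"
      by (rule sys_drop_left[OF sys True \<Lambda> kF h_nonneg H_half H_deriv \<Gamma>_cont \<Gamma>_deriv])
    then show ?thesis
      using \<Gamma>_mono[of \<sigma> 1] \<sigma> neg by (intro exI[of _ "\<Gamma> \<sigma> - \<Gamma> 0"]) (auto simp: \<Psi>_def)
  next
    case False
    have "u \<sigma> - u 1 \<le> P (\<Lambda> / d0) / c0 * (\<Gamma> 1 - \<Gamma> \<sigma>)"
      by (rule sys_drop_right[OF sys _ \<Lambda> kF h_nonneg H_half H_deriv \<Gamma>_cont \<Gamma>_deriv])
         (use False in auto)
    then show ?thesis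
      using \<Gamma>_mono[of 0 \<sigma>] \<sigma> neg eq by (intro exI[of _ "\<Gamma> 1 - \<Gamma> \<sigma>"]) (auto simp: \<Psi>_def)
  qed
  then obtain g where g: "u \<sigma> \<le> P (\<Lambda> / d0) / c0 * g" "g \<le> \<Psi> - 1" by blast
  have "u \<sigma> \<le> P (\<Lambda> / d0) / c0 * (\<Psi> - 1)"
    using g(1) mult_left_mono[OF g(2), of "P (\<Lambda> / d0) / c0"] \<Lambda> c0 d0 by simp
  also have "\<dots> \<le> u \<sigma> / \<Psi> * (\<Psi> - 1)"
    using P \<Gamma>_mono[of 0 1] by (intro mult_right_mono) (auto simp: \<Psi>_def)
  also have "\<dots> < u \<sigma>" using r \<Psi>_pos by (simp add: field_simps)
  finally show False by simp
qed

text \<open>If the end values were nonnegative, \<open>sys_hump\<close> would keep \<open>u\<close>,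
  also at the delayed argument, in the range where the source is large throughout [a,b]. The rise
  forced by \<open>sys_rise\<close> would then exceed the peak.\<close>

lemma deep_drop:
  assumes sys: "peak_system k (\<lambda>x. lam * fplus x) p \<sigma> u w"
    and k: "\<And>t. t \<in> {a..b} \<Longrightarrow> k t = h t" and lam: "0 < lam" and r: "0 < u \<sigma>"
    and large: "\<And>s. s \<in> {\<theta> * u \<sigma>..u \<sigma>} \<Longrightarrow> lam * f s \<ge> \<kappa>2 * \<phi> s"
    and eq: "u 0 = u 1"
  shows "u 0 < 0"
proof (rule ccontr)
  assume nonneg: "\<not> u 0 < 0"
  define K where "K = \<eta> * (\<kappa>2 * \<phi> (\<theta> * u \<sigma>))"
  have \<phi>0: "0 < \<phi> (\<theta> * u \<sigma>)" using \<theta> r by simp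
  have K0: "0 \<le> K" using \<eta> \<kappa>2_pos \<phi>0 by (simp add: K_def)
  have kF: "K \<le> k t * (lam * fplus (u (p t)))" if t: "a \<le> t" "t \<le> b" for t
  proof -
    have t1: "t \<in> {0..1}" using t ab by auto
    have "u \<sigma> \<le> u t * (1 + hump / \<rho>)"
      using sys_hump[OF sys \<rho>(1), of t] \<rho> t nonneg eq by simp
    then have "\<theta> * u \<sigma> \<le> u t"
      using \<rho> hump_nonneg by (simp add: \<theta>_def field_simps add_pos_nonneg)
    then have up: "\<theta> * u \<sigma> \<le> u (p t)" "u (p t) \<le> u \<sigma>"
      using sys_u_delay_ge[OF sys t1] sys_u_le[OF sys, of "p t"] by auto
    have pos: "0 < \<theta> * u \<sigma>" using \<theta> r by simp
    have "\<kappa>2 * \<phi> (\<theta> * u \<sigma>) \<le> \<kappa>2 * \<phi> (u (p t))"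
      using up \<kappa>2_pos by (intro mult_left_mono) auto
    also have "\<dots> \<le> lam * fplus (u (p t))"
      using large[of "u (p t)"] up pos by (simp add: fplus_def max_def)
    finally show ?thesis
      unfolding K_def using k[of t] h_ge[of t] t \<eta> \<kappa>2_pos \<phi>0
      by (intro mult_mono[of \<eta> "k t"]) auto
  qed
  have "\<rho> * (P ((b - a) / 2 * K / d1) / c1) \<le> u \<sigma>"
    by (rule sys_rise[OF sys ab less_imp_le[OF \<rho>(1)] \<rho>(2,3) K0 kF]) (use nonneg eq in auto)
  moreover have "(b - a) / 2 * K / d1 = (\<psi>2 (c1 / (\<rho> * \<theta>)) + 1) * \<phi> (\<theta> * u \<sigma>)"
    using ab \<eta> d1 by (simp add: K_def \<kappa>2_def)
  moreover have "\<phi> (u \<sigma> * c1 / \<rho>) < (\<psi>2 (c1 / (\<rho> * \<theta>)) + 1) * \<phi> (\<theta> * u \<sigma>)"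
  proof -
    have e: "u \<sigma> * c1 / \<rho> = (\<theta> * u \<sigma>) * (c1 / (\<rho> * \<theta>))" using \<theta> by simp
    have "\<phi> (u \<sigma> * c1 / \<rho>) \<le> \<phi> (\<theta> * u \<sigma>) * \<psi>2 (c1 / (\<rho> * \<theta>))"
      unfolding e by (rule phi_mult_le) (use \<theta> \<rho> c1 r in simp_all)
    also have "\<dots> < \<phi> (\<theta> * u \<sigma>) * \<psi>2 (c1 / (\<rho> * \<theta>)) + \<phi> (\<theta> * u \<sigma>)"
      using \<phi>0 by linarith
    also have "\<dots> = (\<psi>2 (c1 / (\<rho> * \<theta>)) + 1) * \<phi> (\<theta> * u \<sigma>)"
      by (simp only: distrib_right mult_1) (simp only: mult.commute)
    finally show ?thesis .
  qed
  ultimately have "\<rho> * (P (\<phi> (u \<sigma> * c1 / \<rho>)) / c1) < u \<sigma>"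
    using \<rho>(1) c1 by (smt (verit, ccfv_threshold) P_less_iff divide_strict_right_mono mult_strict_left_mono)
  then show False using \<rho>(1) c1 by simp
qed

end

section \<open>Continuous convergence\<close>

text \<open>Continuous convergence; for a continuous limit it amounts to uniform convergence on
  compact subsets. In the sequential form, compositions such as \<open>u n (p n (X n))\<close>
  reduce to chaining limits.\<close>

definition cont_conv :: "real set \<Rightarrow> (nat \<Rightarrow> real \<Rightarrow> real) \<Rightarrow> (real \<Rightarrow> real) \<Rightarrow> bool" where
  "cont_conv S g l \<longleftrightarrow> (\<forall>X x. (\<forall>n. X n \<in> S) \<longrightarrow> x \<in> S \<longrightarrow> X \<longlonglongrightarrow> x \<longrightarrow> (\<lambda>n. g n (X n)) \<longlonglongrightarrow> l x)"

lemma cont_convD: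
  "cont_conv S g l \<Longrightarrow> (\<And>n. X n \<in> S) \<Longrightarrow> x \<in> S \<Longrightarrow> X \<longlonglongrightarrow> x \<Longrightarrow> (\<lambda>n. g n (X n)) \<longlonglongrightarrow> l x"
  unfolding cont_conv_def by blast

lemma cont_conv_subseq:
  assumes g: "cont_conv S g l" and q: "strict_mono q"
  shows "cont_conv S (\<lambda>n. g (q n)) l"
  unfolding cont_conv_def
proof (intro allI impI)
  fix X x assume X: "\<forall>n. X n \<in> S" "x \<in> S" "X \<longlonglongrightarrow> x"
  \<comment> \<open>Indices outside the subsequence are filled with the limit point, so that the
    padded sequence still converges.\<close>
  define Y where "Y m = (if m \<in> range q then X (inv q m) else x)" for m
  have Yq: "Y (q j) = X j" for j
    using strict_mono_imp_inj_on[OF q] by (simp add: Y_def)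
  have "Y \<longlonglongrightarrow> x"
  proof (rule tendstoI)
    fix r :: real assume r: "r > 0"
    then obtain J where J: "\<And>j. j \<ge> J \<Longrightarrow> dist (X j) x < r"
      using X(3) unfolding lim_sequentially by blast
    have "dist (Y m) x < r" if "q J \<le> m" for m
    proof (cases "m \<in> range q")
      case True
      then obtain j where "m = q j" by blast
      then show ?thesis using J[of j] that q by (simp add: Yq strict_mono_less_eq)
    qed (use r in \<open>simp add: Y_def\<close>)
    then show "\<forall>\<^sub>F m in sequentially. dist (Y m) x < r"
      unfolding eventually_sequentially by blast
  qed
  then have "(\<lambda>m. g m (Y m)) \<longlonglongrightarrow> l x"
    by (rule cont_convD[OF g, rotated 2]) (use X in \<open>auto simp: Y_def\<close>)
  from LIMSEQ_subseq_LIMSEQ[OF this q] show "(\<lambda>n. g (q n) (X n)) \<longlonglongrightarrow> l x"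
    by (simp add: o_def Yq)
qed

text \<open>The points \<open>\<xi> n\<close> need not converge: they will be intermediate points of
  the mean value theorem. A subsequence violating the claim would have a further convergent
  subsequence, contradicting continuous convergence.\<close>

lemma cont_conv_compact_diff:
  assumes g: "cont_conv S g l" and K: "compact K" "K \<subseteq> S" and l: "continuous_on K l"
    and \<xi>: "\<And>n. \<xi> n \<in> K"
  shows "(\<lambda>n. g n (\<xi> n) - l (\<xi> n)) \<longlonglongrightarrow> 0"
proof (rule ccontr)
  assume "\<not> ?thesis"
  then obtain e where e: "e > 0" and "\<not> (\<forall>\<^sub>F n in sequentially. \<bar>g n (\<xi> n) - l (\<xi> n)\<bar> < e)"
    by (auto simp: tendsto_iff)
  then obtain q :: "nat \<Rightarrow> nat" where q: "strict_mono q" "\<And>j. \<not> \<bar>g (q j) (\<xi> (q j)) - l (\<xi> (q j))\<bar> < e"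
    by (auto dest: not_eventually_sequentiallyD)
  obtain x q' where x: "x \<in> K" and q': "strict_mono q'" "((\<xi> \<circ> q) \<circ> q') \<longlonglongrightarrow> x"
    using K(1) \<xi> unfolding compact_def by (metis comp_apply)
  define Q where "Q = q \<circ> q'"
  have Q: "strict_mono Q" "(\<lambda>j. \<xi> (Q j)) \<longlonglongrightarrow> x"
    using q(1) q' by (auto simp: Q_def o_def strict_mono_def)
  have "(\<lambda>j. g (Q j) (\<xi> (Q j))) \<longlonglongrightarrow> l x"
    by (rule cont_convD[OF cont_conv_subseq[OF g Q(1)] _ _ Q(2)]) (use x \<xi> K(2) in auto)
  moreover have "(\<lambda>j. l (\<xi> (Q j))) \<longlonglongrightarrow> l x"
    by (rule continuous_on_tendsto_compose[OF l Q(2) x]) (use \<xi> in auto)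
  ultimately have "(\<lambda>j. g (Q j) (\<xi> (Q j)) - l (\<xi> (Q j))) \<longlonglongrightarrow> l x - l x"
    by (rule tendsto_diff)
  then have "\<forall>\<^sub>F j in sequentially. \<bar>g (Q j) (\<xi> (Q j)) - l (\<xi> (Q j))\<bar> < e"
    using e unfolding tendsto_iff by (simp add: dist_real_def)
  then obtain j where "\<bar>g (Q j) (\<xi> (Q j)) - l (\<xi> (Q j))\<bar> < e"
    unfolding eventually_sequentially by blast
  then show False using q(2)[of "q' j"] by (simp add: Q_def)
qed

text \<open>The mean value theorem for \<open>F n - L\<close> between \<open>X n\<close> and
  \<open>Z n\<close> reduces the claim to the derivatives at an intermediate point. The base points
  \<open>Z n\<close> may move, because the fluxes are known only at the moving peaks.\<close>

lemma cont_conv_antiderivative: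
  assumes g: "cont_conv {a<..<b} g l" and l: "continuous_on {a<..<b} l"
    and F: "\<And>n x. x \<in> {a<..<b} \<Longrightarrow> (F n has_real_derivative g n x) (at x)"
    and L: "\<And>x. x \<in> {a<..<b} \<Longrightarrow> (L has_real_derivative l x) (at x)"
    and Z: "\<And>n. Z n \<in> {a<..<b}" "z \<in> {a<..<b}" "Z \<longlonglongrightarrow> z" "(\<lambda>n. F n (Z n)) \<longlonglongrightarrow> L z"
  shows "cont_conv {a<..<b} F L"
  unfolding cont_conv_def
proof (intro allI impI)
  fix X x assume X: "\<forall>n. X n \<in> {a<..<b}" "x \<in> {a<..<b}" "X \<longlonglongrightarrow> x"
  have Lc: "continuous_on {a<..<b} L"
    by (rule DERIV_continuous_on, rule has_field_derivative_at_within, rule L)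
  \<comment> \<open>The extreme points of this compact set bound an interval inside (a,b) that
    contains every \<open>X n\<close> and \<open>Z n\<close>, hence all intermediate points.\<close>
  define K where "K = insert x (range X) \<union> insert z (range Z)"
  have K: "compact K" "K \<subseteq> {a<..<b}" "K \<noteq> {}"
    using X Z compact_sequence_with_limit[OF X(3)] compact_sequence_with_limit[OF Z(3)]
    by (auto simp: K_def simp del: Un_insert_left Un_insert_right intro: compact_Un)
  obtain lo where lo: "lo \<in> K" "\<And>y. y \<in> K \<Longrightarrow> lo \<le> y"
    using compact_attains_inf[OF K(1,3)] by blast
  obtain hi where hi: "hi \<in> K" "\<And>y. y \<in> K \<Longrightarrow> y \<le> hi"
    using compact_attains_sup[OF K(1,3)] by blast
  have sub: "{lo..hi} \<subseteq> {a<..<b}" using K(2) lo(1) hi(1) by force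
  have mem: "X n \<in> {lo..hi}" "Z n \<in> {lo..hi}" for n
    using lo(2)[of "X n"] hi(2)[of "X n"] lo(2)[of "Z n"] hi(2)[of "Z n"] by (auto simp: K_def)
  have dFL: "((\<lambda>x. F n x - L x) has_real_derivative g n x - l x) (at x)" if "x \<in> {lo..hi}" for n x
    using that sub by (intro DERIV_diff F L) auto
  have "\<exists>\<xi>\<in>{lo..hi}. (F n (X n) - L (X n)) - (F n (Z n) - L (Z n)) = (X n - Z n) * (g n \<xi> - l \<xi>)" for n
  proof -
    consider "X n = Z n" | "X n < Z n" | "Z n < X n" by linarith
    then show ?thesis
    proof cases
      case 1
      then show ?thesis using mem(1)[of n] by auto
    next
      case 2
      obtain \<xi> where "X n < \<xi>" "\<xi> < Z n"
        "(F n (Z n) - L (Z n)) - (F n (X n) - L (X n)) = (Z n - X n) * (g n \<xi> - l \<xi>)"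
        using MVT2[OF 2, of "\<lambda>x. F n x - L x" "\<lambda>x. g n x - l x"] dFL mem[of n] by force
      then show ?thesis
        using mem[of n] by (intro bexI[of _ \<xi>]) (auto simp: algebra_simps)
    next
      case 3
      obtain \<xi> where "Z n < \<xi>" "\<xi> < X n"
        "(F n (X n) - L (X n)) - (F n (Z n) - L (Z n)) = (X n - Z n) * (g n \<xi> - l \<xi>)"
        using MVT2[OF 3, of "\<lambda>x. F n x - L x" "\<lambda>x. g n x - l x"] dFL mem[of n] by force
      then show ?thesis
        using mem[of n] by (intro bexI[of _ \<xi>]) auto
    qed
  qed
  then obtain \<xi> where \<xi>: "\<And>n. \<xi> n \<in> {lo..hi}"
    "\<And>n. (F n (X n) - L (X n)) - (F n (Z n) - L (Z n)) = (X n - Z n) * (g n (\<xi> n) - l (\<xi> n))"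
    by metis
  have "(\<lambda>n. g n (\<xi> n) - l (\<xi> n)) \<longlonglongrightarrow> 0"
    by (rule cont_conv_compact_diff[OF g compact_Icc sub continuous_on_subset[OF l sub] \<xi>(1)])
  then have "(\<lambda>n. (X n - Z n) * (g n (\<xi> n) - l (\<xi> n))) \<longlonglongrightarrow> (x - z) * 0"
    using X(3) Z(3) by (intro tendsto_intros)
  moreover have "(\<lambda>n. L (X n)) \<longlonglongrightarrow> L x" "(\<lambda>n. L (Z n)) \<longlonglongrightarrow> L z"
    using continuous_on_tendsto_compose[OF Lc X(3,2)] continuous_on_tendsto_compose[OF Lc Z(3,2)] X(1) Z(1) by auto
  ultimately have "(\<lambda>n. (X n - Z n) * (g n (\<xi> n) - l (\<xi> n)) + (F n (Z n) - L (Z n)) + L (X n))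
      \<longlonglongrightarrow> (x - z) * 0 + (L z - L z) + L x"
    using Z(4) by (intro tendsto_add tendsto_diff)
  then show "(\<lambda>n. F n (X n)) \<longlonglongrightarrow> L x"
    by (simp flip: \<xi>(2))
qed

section \<open>Bounds independent of the regularisation\<close>

context sphere_estimates
begin

lemma fplus_cont: "continuous_on UNIV fplus"
  unfolding fplus_def by (rule continuous_on_compose2[OF f_cont]) (auto intro!: continuous_intros)

lemma H_mono:
  assumes "0 < s" "s \<le> t" "t < 1"
  shows "H s \<le> H t"
proof -
  have "(0::real) - 0 \<le> H t - H s"
    by (rule deriv_le_imp_diff_le_closed[of s t "\<lambda>_. 0" "\<lambda>_. 0" H h], fact, rule DERIV_const, rule H_deriv)
       (use assms h_nonneg in auto)
  then show ?thesis by simp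
qed

text \<open>\<open>fplus\<close> is constant on the negative axis, so an upper bound on the peak
  bounds the source however negative \<open>u\<close> becomes.\<close>

lemma source_bounded:
  fixes R lam :: real
  assumes lam: "0 < lam"
  obtains \<Lambda> where "0 \<le> \<Lambda>"
    and "\<And>k p \<sigma> u w t. peak_system k (\<lambda>x. lam * fplus x) p \<sigma> u w \<Longrightarrow> u \<sigma> \<le> R \<Longrightarrow>
      (\<And>t. t \<in> {0<..<1} \<Longrightarrow> k t \<le> h t) \<Longrightarrow> t \<in> {0<..<1} \<Longrightarrow> k t * (lam * fplus (u (p t))) \<le> \<Lambda> * h t"
proof -
  have "compact (fplus ` {min R 0..max R 0})"
    by (intro compact_continuous_image continuous_on_subset[OF fplus_cont]) auto
  then obtain B where B: "\<And>x. x \<in> {min R 0..max R 0} \<Longrightarrow> fplus x \<le> B"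
    using compact_imp_bounded bounded_imp_bdd_above unfolding bdd_above_def by (metis imageI)
  have B': "fplus x \<le> B" if "x \<le> R" for x
    using B[of "max x 0"] that by (force simp: fplus_def)
  show thesis
  proof (rule that[of "lam * max B 0"])
    show "k t * (lam * fplus (u (p t))) \<le> lam * max B 0 * h t"
      if "peak_system k (\<lambda>x. lam * fplus x) p \<sigma> u w" "u \<sigma> \<le> R" "\<And>t. t \<in> {0<..<1} \<Longrightarrow> k t \<le> h t"
        "t \<in> {0<..<1}" for k p \<sigma> u w t
    proof -
      have "u (p t) \<le> R"
        using sys_u_le[OF that(1), of "p t"] sys_u_delay_ge(2)[OF that(1), of t] that by simp
      then have "k t * (lam * fplus (u (p t))) \<le> h t * (lam * max B 0)"
        using that(3)[OF that(4)] lam B' fplus_nonneg[of "u (p t)"] h_nonneg[OF that(4)]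
        by (intro mult_mono mult_left_mono) (auto intro: max.coboundedI1)
      then show ?thesis by (simp add: mult_ac)
    qed
  qed (use lam in auto)
qed

lemma sys_w_bound:
  assumes sys: "peak_system k (\<lambda>x. lam * fplus x) p \<sigma> u w" and \<sigma>: "\<sigma> \<in> {0<..<1}"
    and kF: "\<And>t. t \<in> {0<..<1} \<Longrightarrow> k t * (lam * fplus (u (p t))) \<le> \<Lambda> * h t" and t: "t \<in> {0<..<1}"
  shows "\<bar>w t\<bar> \<le> \<Lambda> * \<bar>H t - H \<sigma>\<bar>"
proof -
  have dH: "((\<lambda>s. \<Lambda> * H s) has_real_derivative \<Lambda> * h x) (at x)" if "x \<in> {0<..<1}" for x
    by (rule DERIV_cmult[OF H_deriv[OF that]])
  have dw: "((\<lambda>s. - w s) has_real_derivative k x * (lam * fplus (u (p x)))) (at x)" if "x \<in> {0<..<1}" for x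
    using DERIV_minus[OF sys_dw[OF sys, of x]] that by simp
  have cmp: "- w y - - w x \<le> \<Lambda> * H y - \<Lambda> * H x" if "0 < x" "x \<le> y" "y < 1" for x y
    by (rule deriv_le_imp_diff_le_closed[OF that(2) dw dH kF]) (use that in auto)
  have \<sigma>0: "w \<sigma> = 0" by (rule sys_w\<sigma>[OF sys])
  show ?thesis
  proof (cases "t \<le> \<sigma>")
    case True
    have "w t \<le> \<Lambda> * (H \<sigma> - H t)" using cmp[of t \<sigma>] True \<sigma> t \<sigma>0 by (simp add: right_diff_distrib)
    moreover have "0 \<le> w t" using sys_w_antimono[OF sys, of t \<sigma>] True \<sigma> t \<sigma>0 by simp
    moreover have "H t \<le> H \<sigma>" using H_mono True \<sigma> t by simp
    ultimately show ?thesis by simp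
  next
    case False
    have "- w t \<le> \<Lambda> * (H t - H \<sigma>)" using cmp[of \<sigma> t] False \<sigma> t \<sigma>0 by (simp add: right_diff_distrib)
    moreover have "w t \<le> 0" using sys_w_antimono[OF sys, of \<sigma> t] False \<sigma> t \<sigma>0 by simp
    moreover have "H \<sigma> \<le> H t" using H_mono False \<sigma> t by simp
    ultimately show ?thesis by simp
  qed
qed

text \<open>A peak close to an end point would have to fall by \<open>r1\<close> across a short
  interval, while the fall is at most a multiple of the increment of \<Gamma> there. Interior peaks
  keep \<open>H \<sigma>\<close> bounded.\<close>

lemma peak_away_from_ends:
  assumes r1: "0 < r1" and \<Lambda>: "0 \<le> \<Lambda>"
  obtains e where "0 < e" "e \<le> 1/2"
    and "\<And>k F p \<sigma> u w. peak_system k F p \<sigma> u w \<Longrightarrow> r1 \<le> u \<sigma> \<Longrightarrow> u 0 = 0 \<Longrightarrow> u 1 = 0 \<Longrightarrow>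
      (\<And>t. t \<in> {0<..<1} \<Longrightarrow> k t * F (u (p t)) \<le> \<Lambda> * h t) \<Longrightarrow> \<sigma> \<in> {e..1-e}"
proof -
  define Y where "Y = P (\<Lambda> / d0) / c0"
  have Y: "0 \<le> Y" using \<Lambda> c0 d0 by (simp add: Y_def)
  \<comment> \<open>Dividing by \<open>Y + 1\<close> rather than \<open>Y\<close> covers
    \<open>Y = 0\<close> and leaves \<open>Y * g\<close> strictly below \<open>r1\<close>.\<close>
  have *: "\<exists>\<epsilon>>0. \<forall>x'\<in>{0..1}. \<bar>x' - x\<bar> < \<epsilon> \<longrightarrow> \<bar>\<Gamma> x' - \<Gamma> x\<bar> < r1 / (Y + 1)" if "x \<in> {0..1}" for x
    using \<Gamma>_cont that r1 Y unfolding continuous_on_iff dist_real_def by simp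
  obtain e0 where e0: "e0 > 0" "\<And>x'. x' \<in> {0..1} \<Longrightarrow> \<bar>x' - 0\<bar> < e0 \<Longrightarrow> \<bar>\<Gamma> x' - \<Gamma> 0\<bar> < r1 / (Y + 1)"
    using *[of 0] by auto
  obtain e1 where e1: "e1 > 0" "\<And>x'. x' \<in> {0..1} \<Longrightarrow> \<bar>x' - 1\<bar> < e1 \<Longrightarrow> \<bar>\<Gamma> x' - \<Gamma> 1\<bar> < r1 / (Y + 1)"
    using *[of 1] by auto
  have small: "Y * g < r1" if "\<bar>g\<bar> < r1 / (Y + 1)" for g
  proof -
    have "Y * g \<le> Y * (r1 / (Y + 1))" using that Y by (intro mult_left_mono) auto
    also have "\<dots> < r1" using r1 Y by (simp add: field_simps)
    finally show ?thesis .
  qed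
  show thesis
  proof (rule that[of "min (1/2) (min e0 e1)"])
    fix k F p \<sigma> u w
    assume sys: "peak_system k F p \<sigma> u w" and u: "r1 \<le> u \<sigma>" "u 0 = 0" "u 1 = 0"
      and kF: "\<And>t. t \<in> {0<..<1} \<Longrightarrow> k t * F (u (p t)) \<le> \<Lambda> * h t"
    have \<sigma>: "0 \<le> \<sigma>" "\<sigma> \<le> 1" using sys_\<sigma>[OF sys] by auto
    have "e0 \<le> \<sigma>" if "\<sigma> \<le> 1/2"
    proof (rule ccontr)
      assume "\<not> e0 \<le> \<sigma>"
      then have "Y * (\<Gamma> \<sigma> - \<Gamma> 0) < r1" using e0(2)[of \<sigma>] \<sigma> by (intro small) auto
      moreover have "u \<sigma> - u 0 \<le> Y * (\<Gamma> \<sigma> - \<Gamma> 0)"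
        unfolding Y_def by (rule sys_drop_left[OF sys that \<Lambda> kF h_nonneg H_half H_deriv \<Gamma>_cont \<Gamma>_deriv])
      ultimately show False using u by simp
    qed
    moreover have "\<sigma> \<le> 1 - e1" if "1/2 \<le> \<sigma>"
    proof (rule ccontr)
      assume "\<not> \<sigma> \<le> 1 - e1"
      then have "Y * (\<Gamma> 1 - \<Gamma> \<sigma>) < r1" using e1(2)[of \<sigma>] \<sigma> by (intro small) (auto simp: abs_minus_commute)
      moreover have "u \<sigma> - u 1 \<le> Y * (\<Gamma> 1 - \<Gamma> \<sigma>)"
        unfolding Y_def by (rule sys_drop_right[OF sys that \<Lambda> kF h_nonneg H_half H_deriv \<Gamma>_cont \<Gamma>_deriv])
      ultimately show False using u by simp
    qed
    ultimately show "\<sigma> \<in> {min (1/2) (min e0 e1)..1 - min (1/2) (min e0 e1)}"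
      using \<sigma> by (cases "\<sigma> \<le> 1/2") (auto simp: min_def)
  qed (use e0 e1 in auto)
qed

text \<open>For \<sigma> in [e,1-e] the flux is at most
  \<open>2 * \<Lambda> * max \<bar>H x\<bar> C\<close> in absolute value. Where
  \<open>\<bar>H x\<bar>\<close> dominates, the slope is at most a multiple of the derivative of
  \<Gamma>; elsewhere a constant bounds it. Hence the two terms of \<open>m\<close>.\<close>

lemma uniform_modulus:
  assumes \<Lambda>: "0 \<le> \<Lambda>" and e: "0 < e" "e \<le> 1/2"
  obtains m where "continuous_on {0..1} m"
    and "\<And>k lam p \<sigma> u w (s::real) t. peak_system k (\<lambda>x. lam * fplus x) p \<sigma> u w \<Longrightarrow> \<sigma> \<in> {e..1-e} \<Longrightarrow>
      (\<And>t. t \<in> {0<..<1} \<Longrightarrow> k t * (lam * fplus (u (p t))) \<le> \<Lambda> * h t) \<Longrightarrow>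
      s \<in> {0..1} \<Longrightarrow> t \<in> {0..1} \<Longrightarrow> \<bar>u s - u t\<bar> \<le> \<bar>m s - m t\<bar>"
proof -
  define C where "C = max \<bar>H e\<bar> \<bar>H (1 - e)\<bar>"
  define A where "A = P (2 * \<Lambda> / d0) / c0"
  define B where "B = P (2 * \<Lambda> * C / d0) / c0"
  have C: "0 \<le> C" by (simp add: C_def)
  define m where "m t = A * \<Gamma> t + B * t" for t
  have mc: "continuous_on {0..1} m"
    unfolding m_def by (intro continuous_intros \<Gamma>_cont)
  have A0: "0 \<le> A" and B0: "0 \<le> B"
    using \<Lambda> C d0 c0 by (simp_all add: A_def B_def)
  have dm: "(m has_real_derivative A * P1 \<bar>H t\<bar> + B) (at t)" if "t \<in> {0<..<1}" for t
    unfolding m_def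
    using DERIV_add[OF DERIV_cmult[OF \<Gamma>_deriv[OF that], of A] DERIV_cmult_Id[of B]] by simp
  show thesis
  proof (rule that[OF mc])
    fix k p u w :: "real \<Rightarrow> real" and lam \<sigma> s t :: real
    assume sys: "peak_system k (\<lambda>x. lam * fplus x) p \<sigma> u w" and \<sigma>: "\<sigma> \<in> {e..1-e}"
      and kF: "\<And>t. t \<in> {0<..<1} \<Longrightarrow> k t * (lam * fplus (u (p t))) \<le> \<Lambda> * h t"
      and st: "s \<in> {0..1}" "t \<in> {0..1::real}"
    have G: "\<bar>G x (w x)\<bar> \<le> A * P1 \<bar>H x\<bar> + B" if x: "x \<in> {0<..<1}" for x
    proof -
      have "\<bar>H \<sigma>\<bar> \<le> C"
        using H_mono[of e \<sigma>] H_mono[of \<sigma> "1 - e"] \<sigma> e by (auto simp: C_def)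
      then have "\<bar>H x - H \<sigma>\<bar> \<le> 2 * max \<bar>H x\<bar> C" by linarith
      moreover have "\<bar>w x\<bar> \<le> \<Lambda> * \<bar>H x - H \<sigma>\<bar>"
        by (rule sys_w_bound[OF sys _ kF x]) (use \<sigma> e in auto)
      ultimately have "\<bar>w x\<bar> \<le> \<Lambda> * (2 * max \<bar>H x\<bar> C)"
        using mult_left_mono[OF _ \<Lambda>] by (meson order_trans)
      then have "\<bar>G x (w x)\<bar> \<le> P (\<Lambda> * (2 * max \<bar>H x\<bar> C) / d0) / c0"
        using x by (intro G_abs_le) auto
      also have "\<dots> \<le> A * P1 \<bar>H x\<bar> + B"
      proof (cases "\<bar>H x\<bar> \<le> C")
        case True
        then have "P (\<Lambda> * (2 * max \<bar>H x\<bar> C) / d0) / c0 = B" by (simp add: B_def mult_ac max_def)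
        then show ?thesis using A0 P1_nonneg[of "\<bar>H x\<bar>"] by simp
      next
        case False
        then have "P (\<Lambda> * (2 * max \<bar>H x\<bar> C) / d0) = P (2 * \<Lambda> / d0 * \<bar>H x\<bar>)"
          by (simp add: mult_ac max_def)
        also have "\<dots> \<le> P (2 * \<Lambda> / d0) * P1 \<bar>H x\<bar>"
          using \<Lambda> d0 by (intro P_mult_le) auto
        finally have "P (\<Lambda> * (2 * max \<bar>H x\<bar> C) / d0) / c0 \<le> P (2 * \<Lambda> / d0) * P1 \<bar>H x\<bar> / c0"
          using c0 by (intro divide_right_mono) auto
        then show ?thesis using B0 by (simp add: A_def)
      qed
      finally show ?thesis .
    qed
    have ord: "\<bar>u y - u x\<bar> \<le> m y - m x" if xy: "0 \<le> x" "x \<le> y" "y \<le> 1" for x y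
    proof -
      have sub: "{x..y} \<subseteq> {0..1}" using xy by auto
      have uc: "continuous_on {x..y} u" by (rule continuous_on_subset[OF sys_cont[OF sys] sub])
      have "u y - u x \<le> m y - m x"
        by (rule deriv_le_imp_diff_le[OF xy(2) uc continuous_on_subset[OF mc sub] sys_du[OF sys] dm])
           (use G xy in \<open>auto simp: abs_le_iff\<close>)
      moreover have "- u y - - u x \<le> m y - m x"
        by (rule deriv_le_imp_diff_le[OF xy(2) continuous_on_minus[OF uc] continuous_on_subset[OF mc sub]
              DERIV_minus[OF sys_du[OF sys]] dm])
           (use G xy in \<open>auto simp: abs_le_iff\<close>)
      ultimately show ?thesis by (simp add: abs_le_iff)
    qed
    show "\<bar>u s - u t\<bar> \<le> \<bar>m s - m t\<bar>"
      using ord[of s t] ord[of t s] st by (cases "s \<le> t") (auto simp: abs_minus_commute)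
  qed
qed

section \<open>Solutions as limits of regularised ones\<close>

text \<open>Differentiability of \<open>v\<close> is not known beforehand. Primitives
  \<open>W\<close> of the limiting source and \<open>Q\<close> of the slope belonging to
  \<open>W\<close> are built first; the fluxes converge to \<open>W\<close>, then the functions
  \<open>u n\<close> to \<open>Q\<close>, so \<open>v\<close> coincides with \<open>Q\<close> on
  (0,1).\<close>

lemma limit_solves:
  fixes k p u w :: "nat \<Rightarrow> real \<Rightarrow> real" and \<sigma> :: "nat \<Rightarrow> real"
  assumes c_cont: "continuous_on {0..1} c" and d_cont: "continuous_on {0..1} d"
    and r1: "0 < r1"
    and sys: "\<And>n. peak_system (k n) (\<lambda>x. lam * fplus x) (p n) (\<sigma> n) (u n) (w n)"
    and bc: "\<And>n. u n 0 = 0" "\<And>n. u n 1 = 0"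
    and peak: "\<And>n. r1 \<le> u n (\<sigma> n)"
    and k_conv: "cont_conv {0<..<1} k h" and p_conv: "cont_conv {0..1} p (\<lambda>t. t)"
    and u_conv: "cont_conv {0..1} u v" and v_cont: "continuous_on {0..1} v"
    and \<sigma>: "\<And>n. \<sigma> n \<in> {0<..<1}" "s \<in> {0<..<1}" "\<sigma> \<longlonglongrightarrow> s"
  shows "is_positive_solution \<phi> c d h f lam v" and "sup_norm01 v = v s" and "(\<lambda>n. u n (\<sigma> n)) \<longlonglongrightarrow> v s"
proof -
  have pt: "(\<lambda>n. u n t) \<longlonglongrightarrow> v t" if "t \<in> {0..1}" for t
    by (rule cont_convD[OF u_conv]) (use that in auto)
  show peak_lim: "(\<lambda>n. u n (\<sigma> n)) \<longlonglongrightarrow> v s"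
    by (rule cont_convD[OF u_conv]) (use \<sigma> in \<open>auto intro: less_imp_le\<close>)
  have v01: "v 0 = 0" "v 1 = 0"
    using pt[of 0] pt[of 1] bc by (auto simp: LIMSEQ_const_iff)
  have v_nonneg: "0 \<le> v t" if "t \<in> {0..1}" for t
    by (rule LIMSEQ_le_const[OF pt[OF that]]) (use sys_u_nonneg[OF sys that] bc in auto)
  have v_le: "v t \<le> v s" if "t \<in> {0..1}" for t
    by (rule LIMSEQ_le[OF pt[OF that] peak_lim]) (use sys_u_le[OF sys that] in auto)
  \<comment> \<open>The lower bound \<open>r1\<close> on the peaks spreads to every interior point
    by \<open>sys_hump\<close>, with a constant independent of \<open>n\<close>.\<close>
  have v_pos: "0 < v t" if t: "t \<in> {0<..<1}" for t
  proof -
    define \<rho>' where "\<rho>' = min t (1 - t)"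
    have \<rho>': "0 < \<rho>'" "\<rho>' \<le> t" "t \<le> 1 - \<rho>'" using t by (auto simp: \<rho>'_def)
    have lim: "(\<lambda>n. u n t * (1 + hump / \<rho>')) \<longlonglongrightarrow> v t * (1 + hump / \<rho>')"
      using t by (intro tendsto_mult pt) auto
    have "r1 \<le> u n t * (1 + hump / \<rho>')" for n
      using sys_hump[OF sys[of n] \<rho>'] bc peak[of n] by simp
    then have "r1 \<le> v t * (1 + hump / \<rho>')"
      by (intro LIMSEQ_le_const[OF lim]) auto
    then have "0 < v t * (1 + hump / \<rho>')" using r1 by simp
    moreover have "0 < 1 + hump / \<rho>'"
      using \<rho>'(1) hump_nonneg by (simp add: add_pos_nonneg)
    ultimately show ?thesis by (rule zero_less_mult_pos2)
  qed
  have fv_cont: "continuous_on {0<..<1} (\<lambda>t. fplus (v t))"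
    by (rule continuous_on_compose2[OF fplus_cont continuous_on_subset[OF v_cont]]) auto
  define rhs where "rhs t = - (h t * (lam * fplus (v t)))" for t
  have rhs_cont: "continuous_on {0<..<1} rhs"
    unfolding rhs_def by (intro continuous_intros h_cont fv_cont)
  obtain W0 where W0: "\<And>t. 0 < t \<Longrightarrow> t < 1 \<Longrightarrow> (W0 has_real_derivative rhs t) (at t)"
    using open_interval_antiderivative[OF zero_less_one rhs_cont] by blast
  define W where "W t = W0 t - W0 s" for t
  have dW: "(W has_real_derivative rhs t) (at t)" if "t \<in> {0<..<1}" for t
    unfolding W_def using DERIV_diff[OF W0[of t] DERIV_const, of "W0 s"] that by simp
  have W_cont: "continuous_on {0<..<1} W"
    by (rule DERIV_continuous_on, rule has_field_derivative_at_within, rule dW)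
  have rhs_conv: "cont_conv {0<..<1} (\<lambda>n t. - (k n t * (lam * fplus (u n (p n t))))) rhs"
    unfolding cont_conv_def
  proof (intro allI impI)
    fix X x assume X: "\<forall>n. X n \<in> {0<..<1}" "x \<in> {0<..<1::real}" "X \<longlonglongrightarrow> x"
    have X': "\<And>n. X n \<in> {0..1}" "x \<in> {0..1}" using X less_imp_le by auto
    have 1: "(\<lambda>n. p n (X n)) \<longlonglongrightarrow> x"
      by (rule cont_convD[OF p_conv X' X(3)])
    have "(\<lambda>n. u n (p n (X n))) \<longlonglongrightarrow> v x"
      by (rule cont_convD[OF u_conv _ X'(2) 1]) (use sys_u_delay_ge(2)[OF sys X'(1)] in auto)
    then have "(\<lambda>n. fplus (u n (p n (X n)))) \<longlonglongrightarrow> fplus (v x)"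
      by (rule continuous_on_tendsto_compose[OF fplus_cont]) auto
    moreover have "(\<lambda>n. k n (X n)) \<longlonglongrightarrow> h x"
      by (rule cont_convD[OF k_conv]) (use X in auto)
    ultimately show "(\<lambda>n. - (k n (X n) * (lam * fplus (u n (p n (X n)))))) \<longlonglongrightarrow> rhs x"
      unfolding rhs_def by (intro tendsto_intros)
  qed
  have w_conv: "cont_conv {0<..<1} w W"
  proof (rule cont_conv_antiderivative[OF rhs_conv rhs_cont _ dW \<sigma>(1,2,3)])
    show "(w n has_real_derivative - (k n x * (lam * fplus (u n (p n x))))) (at x)" if "x \<in> {0<..<1}" for n x
      by (rule sys_dw[OF sys]) (use that in auto)
    show "(\<lambda>n. w n (\<sigma> n)) \<longlonglongrightarrow> W s"
      using sys_w\<sigma>[OF sys] by (simp add: W_def)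
  qed
  have c_pos: "0 < c t" and d_pos: "0 < d t" if "t \<in> {0..1}" for t
    using c_bd[OF that] d_bd[OF that] c0 d0 by auto
  have cc: "continuous_on {0<..<1} c" and dc: "continuous_on {0<..<1} d"
    using c_cont d_cont by (auto elim!: continuous_on_subset)
  define g where "g t = G t (W t)" for t
  have g_cont: "continuous_on {0<..<1} g"
  proof -
    have "continuous_on {0<..<1} (\<lambda>t. W t / d t)"
      by (intro continuous_intros W_cont dc ballI)
         (use d_pos in \<open>auto simp: less_imp_neq[symmetric]\<close>)
    then have "continuous_on {0<..<1} (\<lambda>t. P (W t / d t))"
      by (rule continuous_on_compose2[OF P_cont]) auto
    then show ?thesis
      unfolding g_def G_def by (intro continuous_intros cc ballI) (use c_pos in \<open>auto simp: less_imp_neq[symmetric]\<close>)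
  qed
  have g_conv: "cont_conv {0<..<1} (\<lambda>n t. G t (w n t)) g"
    unfolding cont_conv_def
  proof (intro allI impI)
    fix X x assume X: "\<forall>n. X n \<in> {0<..<1}" "x \<in> {0<..<1::real}" "X \<longlonglongrightarrow> x"
    have 1: "(\<lambda>n. w n (X n)) \<longlonglongrightarrow> W x"
      by (rule cont_convD[OF w_conv]) (use X in auto)
    have 2: "(\<lambda>n. c (X n)) \<longlonglongrightarrow> c x" "(\<lambda>n. d (X n)) \<longlonglongrightarrow> d x"
      using continuous_on_tendsto_compose[OF cc X(3,2)] continuous_on_tendsto_compose[OF dc X(3,2)] X(1) by auto
    have x: "c x \<noteq> 0" "d x \<noteq> 0" using c_pos[of x] d_pos[of x] X(2) by auto
    have "(\<lambda>n. w n (X n) / d (X n)) \<longlonglongrightarrow> W x / d x"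
      by (intro tendsto_divide 1 2 x)
    then have "(\<lambda>n. P (w n (X n) / d (X n))) \<longlonglongrightarrow> P (W x / d x)"
      by (rule continuous_on_tendsto_compose[OF P_cont]) auto
    then show "(\<lambda>n. G (X n) (w n (X n))) \<longlonglongrightarrow> g x"
      unfolding G_def g_def by (intro tendsto_divide 2 x)
  qed
  obtain Q0 where Q0: "\<And>t. 0 < t \<Longrightarrow> t < 1 \<Longrightarrow> (Q0 has_real_derivative g t) (at t)"
    using open_interval_antiderivative[OF zero_less_one g_cont] by blast
  define Q where "Q t = Q0 t + (v s - Q0 s)" for t
  have dQ: "(Q has_real_derivative g t) (at t)" if "t \<in> {0<..<1}" for t
    unfolding Q_def using DERIV_add[OF Q0[of t] DERIV_const, of "v s - Q0 s"] that by simp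
  have Q_conv: "cont_conv {0<..<1} u Q"
  proof (rule cont_conv_antiderivative[OF g_conv g_cont _ dQ, where Z = "\<lambda>_. s" and z = s])
    show "(u n has_real_derivative G x (w n x)) (at x)" if "x \<in> {0<..<1}" for n x
      by (rule sys_du[OF sys]) (use that in auto)
    show "(\<lambda>n. u n s) \<longlonglongrightarrow> Q s"
      using pt[of s] \<sigma>(2) by (simp add: Q_def)
  qed (use \<sigma> in auto)
  have vQ: "Q t = v t" if "t \<in> {0<..<1}" for t
  proof (rule LIMSEQ_unique)
    show "(\<lambda>n. u n t) \<longlonglongrightarrow> Q t"
      by (rule cont_convD[OF Q_conv]) (use that in auto)
  qed (use pt that in auto)
  have dv: "(v has_real_derivative g t) (at t)" if "t \<in> {0<..<1}" for t
    by (rule has_field_derivative_transform_within_open[OF dQ[OF that] _ that]) (use vQ in auto)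
  have flux: "W t = d t * \<phi> (c t * g t)" if "t \<in> {0<..<1}" for t
    using c_pos[of t] d_pos[of t] that by (simp add: g_def G_def)
  have dflux: "((\<lambda>t. d t * \<phi> (c t * g t)) has_real_derivative rhs t) (at t)" if "t \<in> {0<..<1}" for t
    by (rule has_field_derivative_transform_within_open[OF dW[OF that] _ that]) (use flux in auto)
  have eq: "rhs t + lam * h t * f (v t) = 0" if "t \<in> {0<..<1}" for t
    using v_nonneg[of t] that by (simp add: rhs_def fplus_def max_def)
  show "is_positive_solution \<phi> c d h f lam v"
    unfolding is_positive_solution_def is_solution_def
    using v_cont v01 v_pos dv g_cont dflux rhs_cont eq by blast
  show "sup_norm01 v = v s"
    unfolding sup_norm01_def
  proof (rule cSup_eq_maximum)
    show "v s \<in> (\<lambda>t. \<bar>v t\<bar>) ` {0..1}"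
      using \<sigma>(2) v_nonneg[of s] by (intro image_eqI[of _ _ s]) auto
  qed (use v_le v_nonneg in auto)
qed

text \<open>For \<open>N > 0\<close> the factor is 0 within distance 1/N of the end points and 1
  from distance 2/N on, which removes a possible singularity of \<open>h\<close>.\<close>

definition hcut :: "real \<Rightarrow> real \<Rightarrow> real" where
  "hcut N t = (if t \<in> {0<..<1} then h t * max 0 (min 1 (N * min t (1 - t) - 1)) else 0)"

lemma hcut_bounds:
  shows "0 \<le> hcut N t" and "t \<in> {0<..<1} \<Longrightarrow> hcut N t \<le> h t"
  using h_nonneg[of t] by (auto simp: hcut_def intro!: mult_left_le)

lemma hcut_eq: "t \<in> {0<..<1} \<Longrightarrow> 2 \<le> N * min t (1 - t) \<Longrightarrow> hcut N t = h t"
  unfolding hcut_def by simp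

lemma hcut_cont:
  assumes N: "0 < N"
  shows "continuous_on UNIV (hcut N)"
proof -
  have 1: "continuous_on {0<..<1} (hcut N)"
  proof -
    have "continuous_on {0<..<1} (\<lambda>t. h t * max 0 (min 1 (N * min t (1 - t) - 1)))"
      by (intro continuous_intros h_cont)
    then show ?thesis
      by (rule continuous_on_eq) (auto simp: hcut_def)
  qed
  define S where "S = {t. N * min t (1 - t) < 1}"
  have "open S"
    unfolding S_def by (intro open_Collect_less continuous_intros)
  have "continuous_on S (hcut N)"
    by (rule continuous_on_eq[OF continuous_on_const[of _ 0]]) (auto simp: S_def hcut_def)
  then have "continuous_on ({0<..<1} \<union> S) (hcut N)"
    using 1 \<open>open S\<close> by (intro continuous_on_open_Un) auto
  moreover have "t \<in> S" if "t \<notin> {0<..<1}" for t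
  proof -
    have "min t (1 - t) \<le> 0" using that by auto
    then have "N * min t (1 - t) \<le> 0" using N by (simp add: mult_nonneg_nonpos)
    then show ?thesis by (simp add: S_def)
  qed
  then have "{0<..<1} \<union> S = UNIV" by blast
  ultimately show ?thesis by simp
qed

lemma hcut_conv:
  fixes N0 :: real
  shows "cont_conv {0<..<1} (\<lambda>n. hcut (real n + N0)) h"
  unfolding cont_conv_def
proof (intro allI impI)
  fix X x assume X: "\<forall>n. X n \<in> {0<..<1}" "x \<in> {0<..<1::real}" "X \<longlonglongrightarrow> x"
  define \<mu> where "\<mu> = min x (1 - x)"
  have \<mu>: "0 < \<mu>" using X(2) by (auto simp: \<mu>_def)
  have "(\<lambda>n. min (X n) (1 - X n)) \<longlonglongrightarrow> \<mu>"
    unfolding \<mu>_def using X(3) by (intro tendsto_intros)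
  then have ev: "\<forall>\<^sub>F n in sequentially. \<mu> / 2 < min (X n) (1 - X n)"
    by (rule order_tendstoD(1)) (use \<mu> in simp)
  have "filterlim (\<lambda>n. real n + N0) at_top sequentially"
    using filterlim_tendsto_add_at_top[OF tendsto_const[of N0] filterlim_real_sequentially]
    by (simp add: add.commute)
  then have "\<forall>\<^sub>F n in sequentially. 4 / \<mu> \<le> real n + N0"
    by (simp add: filterlim_at_top)
  with ev have "\<forall>\<^sub>F n in sequentially. h (X n) = hcut (real n + N0) (X n)"
  proof eventually_elim
    case (elim n)
    have "2 = 4 / \<mu> * (\<mu> / 2)" using \<mu> by simp
    also have "\<dots> \<le> (real n + N0) * min (X n) (1 - X n)"
      using elim \<mu> by (intro mult_mono) (auto intro: order_trans[of _ "4 / \<mu>"])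
    finally show ?case using hcut_eq[of "X n"] X(1) by simp
  qed
  moreover have "(\<lambda>n. h (X n)) \<longlonglongrightarrow> h x"
    by (rule continuous_on_tendsto_compose[OF h_cont X(3,2)]) (use X in auto)
  ultimately show "(\<lambda>n. hcut (real n + N0) (X n)) \<longlonglongrightarrow> h x"
    by (rule Lim_transform_eventually[rotated])
qed

text \<open>The alternatives in \<open>bd\<close> are the superlinear and the sublinear
  configuration. The points \<open>x\<close> and \<open>y\<close> record that the peak height
  reached violates the hypotheses of \<open>no_drop\<close> and \<open>deep_drop\<close>;
  \<open>2 \<le> N * \<rho>\<close> keeps the cut-off away from [a,b].\<close>

lemma approximate_solution:
  assumes c_cont: "continuous_on {0..1} c" and d_cont: "continuous_on {0..1} d"
    and lam: "0 < lam" and r: "0 < r1" "r1 < r2"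
    and N: "0 < N" "2 \<le> N * \<rho>" and \<delta>: "0 < \<delta>"
    and bd: "((\<forall>s\<in>{0..r1}. lam * f s \<le> \<kappa>1 * \<phi> r1) \<and> (\<forall>s\<in>{\<theta> * r2..r2}. lam * f s \<ge> \<kappa>2 * \<phi> s)) \<or>
      ((\<forall>s\<in>{\<theta> * r1..r1}. lam * f s \<ge> \<kappa>2 * \<phi> s) \<and> (\<forall>s\<in>{0..r2}. lam * f s \<le> \<kappa>1 * \<phi> r2))"
  obtains \<sigma> u w x y where "peak_system (hcut N) (\<lambda>x. lam * fplus x) (delay \<delta> \<sigma>) \<sigma> u w"
    and "u 0 = 0" "u 1 = 0" "r1 \<le> u \<sigma>" "u \<sigma> \<le> r2"
    and "x \<in> {0..u \<sigma>}" "\<kappa>1 * \<phi> (u \<sigma>) \<le> lam * f x"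
    and "y \<in> {\<theta> * u \<sigma>..u \<sigma>}" "lam * f y \<le> \<kappa>2 * \<phi> y"
proof -
  \<comment> \<open>\<open>delayed_ivp\<close> wants coefficients continuous on the whole line, so
    the weights are frozen outside [0,1].\<close>
  define cl where "cl t = max 0 (min 1 t)" for t :: real
  have cl: "cl t \<in> {0..1}" for t by (auto simp: cl_def)
  have clc: "continuous_on UNIV (\<lambda>t. c (cl t))" "continuous_on UNIV (\<lambda>t. d (cl t))"
    using cl by (auto simp: cl_def intro!: continuous_on_compose2[OF c_cont] continuous_on_compose2[OF d_cont] continuous_intros)
  have cd_pos: "0 < c (cl t)" "0 < d (cl t)" for t
    using c_bd[OF cl] d_bd[OF cl] c0 d0 by (meson less_le_trans)+
  define G' where "G' t w = P (w / d (cl t)) / c (cl t)" for t w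
  have G'c: "continuous_on UNIV (\<lambda>(t, w). G' t w)"
  proof -
    have fc: "continuous_on UNIV (\<lambda>z::real\<times>real. c (cl (fst z)))" "continuous_on UNIV (\<lambda>z::real\<times>real. d (cl (fst z)))"
      using clc by (auto intro: continuous_on_compose2[OF _ continuous_on_fst[OF continuous_on_id]])
    have "continuous_on UNIV (\<lambda>z. snd z / d (cl (fst z)))"
      by (intro continuous_intros fc) (use cd_pos in \<open>auto simp: less_imp_neq[symmetric]\<close>)
    then have "continuous_on UNIV (\<lambda>z. P (snd z / d (cl (fst z))))"
      by (rule continuous_on_compose2[OF P_cont]) auto
    then have "continuous_on UNIV (\<lambda>z. P (snd z / d (cl (fst z))) / c (cl (fst z)))"
      by (intro continuous_intros fc) (use cd_pos in \<open>auto simp: less_imp_neq[symmetric]\<close>)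
    then show ?thesis by (simp add: G'_def case_prod_unfold)
  qed
  have G'G: "G' t w = G t w" if "t \<in> {0..1}" for t w
    using that by (simp add: G'_def G_def cl_def)
  obtain u w :: "real \<times> real \<Rightarrow> real \<Rightarrow> real"
    where uc: "continuous_on UNIV (\<lambda>(x, t). u x t)"
    and u0: "\<And>\<sigma> r. u (\<sigma>, r) \<sigma> = r" and w0: "\<And>\<sigma> r. w (\<sigma>, r) \<sigma> = 0"
    and du: "\<And>\<sigma> r t. (u (\<sigma>, r) has_real_derivative G' t (w (\<sigma>, r) t)) (at t)"
    and dw: "\<And>\<sigma> r t. \<sigma> \<in> {0..1} \<Longrightarrow> t \<in> {0..1} \<Longrightarrow>
           (w (\<sigma>, r) has_real_derivative - (hcut N t * (lam * fplus (u (\<sigma>, r) (delay \<delta> \<sigma> t))))) (at t)"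
    using delayed_ivp[OF G'c hcut_cont[OF N(1)] continuous_on_mult[OF continuous_on_const[of _ lam] fplus_cont] \<delta>] by blast
  have sys: "peak_system (hcut N) (\<lambda>x. lam * fplus x) (delay \<delta> \<sigma>) \<sigma> (u (\<sigma>, r)) (w (\<sigma>, r))"
    if "\<sigma> \<in> {0..1}" for \<sigma> r
    unfolding peak_system_def
  proof (intro conjI ballI allI)
    fix t :: real assume t: "t \<in> {0..1}"
    show "(u (\<sigma>, r) has_real_derivative G t (w (\<sigma>, r) t)) (at t)"
      using du[of \<sigma> r t] unfolding G'G[OF t] .
    show "t \<le> \<sigma> \<longrightarrow> t \<le> delay \<delta> \<sigma> t \<and> delay \<delta> \<sigma> t \<le> \<sigma>"
      "\<sigma> \<le> t \<longrightarrow> \<sigma> \<le> delay \<delta> \<sigma> t \<and> delay \<delta> \<sigma> t \<le> t"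
      using delay_bounds(1)[of \<delta> t \<sigma>] delay_bounds(2)[of \<delta> \<sigma> t] \<delta> by auto
  qed (use that w0 dw hcut_bounds(1) fplus_nonneg lam in auto)
  define A where "A x = u x 0" for x
  define B where "B x = u x 1" for x
  have "continuous_on UNIV (\<lambda>x. (\<lambda>(x, t). u x t) (x, t))" for t
    by (rule continuous_on_compose2[OF uc]) (auto intro!: continuous_intros)
  then have ABc: "continuous_on UNIV A" "continuous_on UNIV B"
    by (simp_all add: A_def[abs_def] B_def[abs_def])
  have left: "B (0, r) \<le> A (0, r)" and right: "A (1, r) \<le> B (1, r)" for r
    using sys_u_le[OF sys[of 0 r], of 1] sys_u_le[OF sys[of 1 r], of 0] by (auto simp: A_def B_def)
  have hN: "hcut N t = h t" if "t \<in> {a..b}" for t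
  proof (rule hcut_eq)
    have "N * \<rho> \<le> N * min t (1 - t)"
      using that N(1) by (intro mult_left_mono) (auto simp: \<rho>_def)
    then show "2 \<le> N * min t (1 - t)" using N(2) by simp
  qed (use that ab in auto)
  have nd: "0 < A (\<sigma>, r)" if "\<sigma> \<in> {0..1}" "0 < r" "A (\<sigma>, r) = B (\<sigma>, r)" "\<forall>s\<in>{0..r}. lam * f s \<le> \<kappa>1 * \<phi> r" for \<sigma> r
    unfolding A_def by (rule no_drop[OF sys[OF that(1)] hcut_bounds(2) lam]) (use that u0 in \<open>auto simp: A_def B_def\<close>)
  have dd: "A (\<sigma>, r) < 0" if "\<sigma> \<in> {0..1}" "0 < r" "A (\<sigma>, r) = B (\<sigma>, r)" "\<forall>s\<in>{\<theta> * r..r}. lam * f s \<ge> \<kappa>2 * \<phi> s" for \<sigma> r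
    unfolding A_def by (rule deep_drop[OF sys[OF that(1)] hN lam]) (use that u0 in \<open>auto simp: A_def B_def\<close>)
  have "\<exists>\<sigma> r. \<sigma> \<in> {0..1} \<and> r \<in> {r1..r2} \<and> A (\<sigma>, r) = 0 \<and> B (\<sigma>, r) = 0"
    using bd
  proof
    assume h: "(\<forall>s\<in>{0..r1}. lam * f s \<le> \<kappa>1 * \<phi> r1) \<and> (\<forall>s\<in>{\<theta> * r2..r2}. lam * f s \<ge> \<kappa>2 * \<phi> s)"
    obtain \<sigma> r where "\<sigma> \<in> {0..1}" "r \<in> {r1..r2}" "A (\<sigma>, r) = 0" "B (\<sigma>, r) = 0"
    proof (rule common_zero_on_rectangle[of r1 r2 A B])
      show "0 < A (\<sigma>, r1)" if "\<sigma> \<in> {0..1}" "A (\<sigma>, r1) = B (\<sigma>, r1)" for \<sigma>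
        using nd[of \<sigma> r1] that h r by simp
      show "A (\<sigma>, r2) < 0" if "\<sigma> \<in> {0..1}" "A (\<sigma>, r2) = B (\<sigma>, r2)" for \<sigma>
        using dd[of \<sigma> r2] that h r by simp
    qed (use ABc left right r in auto)
    then show ?thesis by blast
  next
    assume h: "(\<forall>s\<in>{\<theta> * r1..r1}. lam * f s \<ge> \<kappa>2 * \<phi> s) \<and> (\<forall>s\<in>{0..r2}. lam * f s \<le> \<kappa>1 * \<phi> r2)"
    \<comment> \<open>The signs on the bottom and top sides are now reversed. Passing to the
      negatives restores them, and exchanging \<open>A\<close> and \<open>B\<close> as well
      preserves the inequalities at \<sigma> = 0 and \<sigma> = 1.\<close>
    obtain \<sigma> r where "\<sigma> \<in> {0..1}" "r \<in> {r1..r2}" "- B (\<sigma>, r) = 0" "- A (\<sigma>, r) = 0"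
    proof (rule common_zero_on_rectangle[of r1 r2 "\<lambda>x. - B x" "\<lambda>x. - A x"])
      show "- B (\<sigma>, r1) > 0" if "\<sigma> \<in> {0..1}" "- B (\<sigma>, r1) = - A (\<sigma>, r1)" for \<sigma>
        using dd[of \<sigma> r1] that h r by simp
      show "- B (\<sigma>, r2) < 0" if "\<sigma> \<in> {0..1}" "- B (\<sigma>, r2) = - A (\<sigma>, r2)" for \<sigma>
        using nd[of \<sigma> r2] that h r by simp
    qed (use ABc left right r in \<open>auto intro!: continuous_intros\<close>)
    then show ?thesis by auto
  qed
  then obtain \<sigma> r where *: "\<sigma> \<in> {0..1}" "r \<in> {r1..r2}" "A (\<sigma>, r) = 0" "B (\<sigma>, r) = 0"
    by blast
  have "\<not> (\<forall>s\<in>{0..r}. lam * f s \<le> \<kappa>1 * \<phi> r)" "\<not> (\<forall>s\<in>{\<theta> * r..r}. lam * f s \<ge> \<kappa>2 * \<phi> s)"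
    using nd[of \<sigma> r] dd[of \<sigma> r] * r by auto
  then obtain x y where "x \<in> {0..r}" "\<kappa>1 * \<phi> r \<le> lam * f x" "y \<in> {\<theta> * r..r}" "lam * f y \<le> \<kappa>2 * \<phi> y"
    by (meson linear)
  then show thesis
    using that[OF sys[OF *(1), of r], of x y] * u0 by (simp add: A_def B_def)
qed

text \<open>The last two clauses say that the sphere of radius \<open>sup_norm01 v\<close> is excluded neither by
  \<open>no_drop\<close> nor by \<open>deep_drop\<close>; they control the norm as \<open>lam\<close> tends to \<open>0\<close> or \<open>\<infinity>\<close>.\<close>
definition localized_solution :: "real \<Rightarrow> (real \<Rightarrow> real) \<Rightarrow> bool" where
  "localized_solution lam v \<longleftrightarrow> is_positive_solution \<phi> c d h f lam v \<and> 0 < sup_norm01 v \<and>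
     (\<exists>x\<in>{0..sup_norm01 v}. \<kappa>1 * \<phi> (sup_norm01 v) \<le> lam * f x) \<and>
     (\<exists>y\<in>{\<theta> * sup_norm01 v..sup_norm01 v}. lam * f y \<le> \<kappa>2 * \<phi> y)"

text \<open>The bounds on peak location and modulus do not involve the regularisation, and the
  localizing inequalities are closed conditions, so both pass to a limit along a
  subsequence.\<close>

lemma localized_solution_exists:
  assumes c_cont: "continuous_on {0..1} c" and d_cont: "continuous_on {0..1} d"
    and lam: "0 < lam" and r: "0 < r1" "r1 < r2"
    and bd: "((\<forall>s\<in>{0..r1}. lam * f s \<le> \<kappa>1 * \<phi> r1) \<and> (\<forall>s\<in>{\<theta> * r2..r2}. lam * f s \<ge> \<kappa>2 * \<phi> s)) \<or>
      ((\<forall>s\<in>{\<theta> * r1..r1}. lam * f s \<ge> \<kappa>2 * \<phi> s) \<and> (\<forall>s\<in>{0..r2}. lam * f s \<le> \<kappa>1 * \<phi> r2))"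
  shows "\<exists>v. localized_solution lam v"
proof -
  \<comment> \<open>The offset gives \<open>2 \<le> N n * \<rho>\<close> for every \<open>n\<close>,
    including 0.\<close>
  define N where "N n = real n + (2 / \<rho> + 1)" for n :: nat
  define \<delta> where "\<delta> n = 1 / real (Suc n)" for n
  have N: "0 < N n" "2 \<le> N n * \<rho>" for n
    using \<rho>(1) by (auto simp: N_def algebra_simps add_pos_nonneg)
  have "\<exists>\<sigma> u w x y. peak_system (hcut (N n)) (\<lambda>x. lam * fplus x) (delay (\<delta> n) \<sigma>) \<sigma> u w \<and>
      u 0 = 0 \<and> u 1 = 0 \<and> r1 \<le> u \<sigma> \<and> u \<sigma> \<le> r2 \<and>
      x \<in> {0..u \<sigma>} \<and> \<kappa>1 * \<phi> (u \<sigma>) \<le> lam * f x \<and>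
      y \<in> {\<theta> * u \<sigma>..u \<sigma>} \<and> lam * f y \<le> \<kappa>2 * \<phi> y" for n
    by (rule approximate_solution[OF c_cont d_cont lam r N(1,2)[of n] _ bd, of "\<delta> n"])
       (simp add: \<delta>_def, blast)
  then obtain \<sigma> u w x y where
    sys: "\<And>n. peak_system (hcut (N n)) (\<lambda>x. lam * fplus x) (delay (\<delta> n) (\<sigma> n)) (\<sigma> n) (u n) (w n)"
    and bc: "\<And>n. u n 0 = 0" "\<And>n. u n 1 = 0"
    and peak: "\<And>n. r1 \<le> u n (\<sigma> n)" "\<And>n. u n (\<sigma> n) \<le> r2"
    and x: "\<And>n. x n \<in> {0..u n (\<sigma> n)}" "\<And>n. \<kappa>1 * \<phi> (u n (\<sigma> n)) \<le> lam * f (x n)"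
    and y: "\<And>n. y n \<in> {\<theta> * u n (\<sigma> n)..u n (\<sigma> n)}" "\<And>n. lam * f (y n) \<le> \<kappa>2 * \<phi> (y n)"
    by metis
  obtain \<Lambda> where \<Lambda>: "0 \<le> \<Lambda>"
    and src: "\<And>k p \<sigma> u w t. peak_system k (\<lambda>x. lam * fplus x) p \<sigma> u w \<Longrightarrow> u \<sigma> \<le> r2 \<Longrightarrow>
      (\<And>t. t \<in> {0<..<1} \<Longrightarrow> k t \<le> h t) \<Longrightarrow> t \<in> {0<..<1} \<Longrightarrow> k t * (lam * fplus (u (p t))) \<le> \<Lambda> * h t"
    using source_bounded[OF lam, of r2] by blast
  have kF: "hcut (N n) t * (lam * fplus (u n (delay (\<delta> n) (\<sigma> n) t))) \<le> \<Lambda> * h t" if "t \<in> {0<..<1}" for n t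
    by (rule src[OF sys peak(2) hcut_bounds(2) that])
  obtain e where e: "0 < e" "e \<le> 1/2"
    and away: "\<And>k F p \<sigma> u w. peak_system k F p \<sigma> u w \<Longrightarrow> r1 \<le> u \<sigma> \<Longrightarrow> u 0 = 0 \<Longrightarrow> u 1 = 0 \<Longrightarrow>
      (\<And>t. t \<in> {0<..<1} \<Longrightarrow> k t * F (u (p t)) \<le> \<Lambda> * h t) \<Longrightarrow> \<sigma> \<in> {e..1-e}"
    using peak_away_from_ends[OF r(1) \<Lambda>] by metis
  have \<sigma>e: "\<sigma> n \<in> {e..1-e}" for n
    by (rule away[OF sys peak(1) bc kF])
  obtain m where m: "continuous_on {0..1} m"
    and modulus: "\<And>k lam p \<sigma> u w (s::real) t. peak_system k (\<lambda>x. lam * fplus x) p \<sigma> u w \<Longrightarrow> \<sigma> \<in> {e..1-e} \<Longrightarrow>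
      (\<And>t. t \<in> {0<..<1} \<Longrightarrow> k t * (lam * fplus (u (p t))) \<le> \<Lambda> * h t) \<Longrightarrow>
      s \<in> {0..1} \<Longrightarrow> t \<in> {0..1} \<Longrightarrow> \<bar>u s - u t\<bar> \<le> \<bar>m s - m t\<bar>"
    using uniform_modulus[OF \<Lambda> e] by metis
  have mod: "\<bar>u n s - u n t\<bar> \<le> \<bar>m s - m t\<bar>" if "s \<in> {0..1}" "t \<in> {0..1}" for n s t
    by (rule modulus[OF sys \<sigma>e kF that])
  have xy: "x n \<in> {0..r2}" "y n \<in> {0..r2}" for n
  proof -
    have "0 \<le> \<theta> * u n (\<sigma> n)" using \<theta>(1) peak(1)[of n] r by simp
    then show "x n \<in> {0..r2}" "y n \<in> {0..r2}" using x(1)[of n] y(1)[of n] peak(2)[of n] by auto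
  qed
  \<comment> \<open>Peaks and witnesses are made to converge together before Arzela-Ascoli thins out
    the sequence once more.\<close>
  have "compact ({e..1-e} \<times> {0..r2} \<times> {0..r2})"
    by (intro compact_Times compact_Icc)
  moreover have "\<forall>n. (\<sigma> n, x n, y n) \<in> {e..1-e} \<times> {0..r2} \<times> {0..r2}"
    using \<sigma>e xy by blast
  ultimately obtain l q0 where l: "l \<in> {e..1-e} \<times> {0..r2} \<times> {0..r2}" and q0: "strict_mono q0"
    and lim0: "((\<lambda>n. (\<sigma> n, x n, y n)) \<circ> q0) \<longlonglongrightarrow> l"
    unfolding compact_def by meson
  obtain s x0 y0 where le: "l = (s, x0, y0)" by (metis prod.collapse)
  have lims0: "(\<lambda>n. \<sigma> (q0 n)) \<longlonglongrightarrow> s" "(\<lambda>n. x (q0 n)) \<longlonglongrightarrow> x0" "(\<lambda>n. y (q0 n)) \<longlonglongrightarrow> y0"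
    using tendsto_fst[OF lim0] tendsto_fst[OF tendsto_snd[OF lim0]] tendsto_snd[OF tendsto_snd[OF lim0]]
    by (simp_all add: le o_def)
  have l01: "s \<in> {0<..<1}" "0 \<le> x0" "0 \<le> y0" using l e by (auto simp: le)
  obtain v q1 where v: "continuous_on {0..1} v" and q1: "strict_mono (q1 :: nat \<Rightarrow> nat)"
    and unif: "\<And>\<epsilon>. 0 < \<epsilon> \<Longrightarrow> \<exists>M. \<forall>n t. M \<le> n \<and> t \<in> {0..1} \<longrightarrow> norm (u (q0 (q1 n)) t - v t) < \<epsilon>"
  proof (rule Arzela_Ascoli[of "{0..1::real}" "\<lambda>n. u (q0 n)" r2])
    show "norm (u (q0 n) t) \<le> r2" if "t \<in> {0..1}" for n t
      using sys_u_nonneg[OF sys that] sys_u_le[OF sys that] bc peak(2) by (fastforce intro: order_trans)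
    show "\<exists>d>0. \<forall>n y. y \<in> {0..1} \<and> norm (t - y) < d \<longrightarrow> norm (u (q0 n) t - u (q0 n) y) < \<epsilon>"
      if t: "t \<in> {0..1}" and \<epsilon>: "0 < \<epsilon>" for t \<epsilon>
    proof -
      obtain d where d: "d > 0" "\<And>y. y \<in> {0..1} \<Longrightarrow> dist y t < d \<Longrightarrow> dist (m y) (m t) < \<epsilon>"
        using m t \<epsilon> unfolding continuous_on_iff by blast
      have "norm (u (q0 n) t - u (q0 n) y) < \<epsilon>" if "y \<in> {0..1}" "norm (t - y) < d" for n y
        using mod[OF t that(1), of "q0 n"] d(2)[of y] that by (simp add: dist_real_def abs_minus_commute)
      then show ?thesis using d(1) by blast
    qed
  qed auto
  define q where "q = q0 \<circ> q1"
  have q: "strict_mono q" using q0 q1 by (simp add: q_def strict_mono_o)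
  have lims: "(\<lambda>n. \<sigma> (q n)) \<longlonglongrightarrow> s" "(\<lambda>n. x (q n)) \<longlonglongrightarrow> x0" "(\<lambda>n. y (q n)) \<longlonglongrightarrow> y0"
    using lims0[THEN LIMSEQ_subseq_LIMSEQ, OF q1] by (simp_all add: q_def o_def)
  have u_conv: "cont_conv {0..1} (\<lambda>n. u (q n)) v"
    unfolding cont_conv_def
  proof (intro allI impI)
    fix X t assume X: "\<forall>n. X n \<in> {0..1}" "t \<in> {0..1::real}" "X \<longlonglongrightarrow> t"
    have "(\<lambda>n. u (q n) (X n) - v (X n)) \<longlonglongrightarrow> 0"
      unfolding LIMSEQ_iff q_def comp_apply diff_zero using unif X(1) by meson
    moreover have "(\<lambda>n. v (X n)) \<longlonglongrightarrow> v t"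
      by (rule continuous_on_tendsto_compose[OF v X(3,2)]) (use X in auto)
    ultimately have "(\<lambda>n. (u (q n) (X n) - v (X n)) + v (X n)) \<longlonglongrightarrow> 0 + v t"
      by (rule tendsto_add)
    then show "(\<lambda>n. u (q n) (X n)) \<longlonglongrightarrow> v t" by simp
  qed
  have k_conv: "cont_conv {0<..<1} (\<lambda>n. hcut (N (q n))) h"
    using cont_conv_subseq[OF hcut_conv q] by (simp add: N_def)
  have \<delta>0: "(\<lambda>n. \<delta> (q n)) \<longlonglongrightarrow> 0"
    using LIMSEQ_subseq_LIMSEQ[OF LIMSEQ_inverse_real_of_nat q]
    by (simp add: \<delta>_def[abs_def] o_def inverse_eq_divide)
  have p_conv: "cont_conv {0..1} (\<lambda>n. delay (\<delta> (q n)) (\<sigma> (q n))) (\<lambda>t. t)"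
    unfolding cont_conv_def
  proof (intro allI impI)
    fix X t assume X: "X \<longlonglongrightarrow> (t::real)"
    have "(\<lambda>n. delay (\<delta> (q n)) (\<sigma> (q n)) (X n) - X n) \<longlonglongrightarrow> 0"
      by (rule Lim_null_comparison[OF _ \<delta>0]) (auto intro!: always_eventually delay_near simp: \<delta>_def)
    from tendsto_add[OF this X] show "(\<lambda>n. delay (\<delta> (q n)) (\<sigma> (q n)) (X n)) \<longlonglongrightarrow> t" by simp
  qed
  have \<sigma>01: "\<sigma> (q n) \<in> {0<..<1}" for n using \<sigma>e[of "q n"] e by auto
  note sol = limit_solves[OF c_cont d_cont r(1) sys bc(1) bc(2) peak(1) k_conv p_conv u_conv v \<sigma>01 l01(1) lims(1)]
  define R where "R = v s"
  have R: "sup_norm01 v = R" using sol(2) by (simp add: R_def)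
  have limR: "(\<lambda>n. u (q n) (\<sigma> (q n))) \<longlonglongrightarrow> R" using sol(3) by (simp add: R_def)
  have R1: "r1 \<le> R" by (rule LIMSEQ_le_const[OF limR]) (use peak in auto)
  have \<phi>lim: "(\<lambda>n. \<phi> (z n)) \<longlonglongrightarrow> \<phi> z0" if "z \<longlonglongrightarrow> z0" for z z0
    by (rule continuous_on_tendsto_compose[OF phi_cont that]) auto
  have flim: "(\<lambda>n. f (z n)) \<longlonglongrightarrow> f z0" if "z \<longlonglongrightarrow> z0" "\<And>n. 0 \<le> z n" "0 \<le> z0" for z z0
    by (rule continuous_on_tendsto_compose[OF f_cont that(1)]) (use that in auto)
  have "x0 \<le> R" "\<kappa>1 * \<phi> R \<le> lam * f x0"
    by (rule LIMSEQ_le[OF lims(2) limR], use x in force,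
        rule LIMSEQ_le[OF tendsto_mult_left[OF \<phi>lim[OF limR]] tendsto_mult_left[OF flim[OF lims(2)]]],
        use x xy l01 in auto)
  moreover have "\<theta> * R \<le> y0" "y0 \<le> R" "lam * f y0 \<le> \<kappa>2 * \<phi> y0"
    by (rule LIMSEQ_le[OF tendsto_mult_left[OF limR] lims(3)], use y in force,
        rule LIMSEQ_le[OF lims(3) limR], use y in force,
        rule LIMSEQ_le[OF tendsto_mult_left[OF flim[OF lims(3)]] tendsto_mult_left[OF \<phi>lim[OF lims(3)]]],
        use y xy l01 in auto)
  ultimately have "localized_solution lam v"
    unfolding localized_solution_def R using sol(1) R1 r(1) l01 by (auto intro!: bexI)
  then show ?thesis by blast
qed

text \<open>The asymptotics hold for every localized solution, so an arbitrary choice for each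
  \<open>lam\<close> suffices. The filters are abstract because the roles of
  \<open>at_right 0\<close> and \<open>at_top\<close> differ in the two cases.\<close>

lemma solution_branch:
  assumes ex: "\<And>lam. 0 < lam \<Longrightarrow> \<exists>v. localized_solution lam v"
    and pos: "\<forall>\<^sub>F lam in F1. 0 < lam" "\<forall>\<^sub>F lam in F2. 0 < lam"
    and big: "\<And>Z. 0 < Z \<Longrightarrow> \<forall>\<^sub>F lam in F1. \<forall>v. localized_solution lam v \<longrightarrow> Z \<le> sup_norm01 v"
    and small: "\<And>\<epsilon>. 0 < \<epsilon> \<Longrightarrow> \<forall>\<^sub>F lam in F2. \<forall>v. localized_solution lam v \<longrightarrow> sup_norm01 v < \<epsilon>"
  shows "\<exists>U. (\<forall>lam>0. is_positive_solution \<phi> c d h f lam (U lam)) \<and>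
    filterlim (\<lambda>lam. sup_norm01 (U lam)) at_top F1 \<and> ((\<lambda>lam. sup_norm01 (U lam)) \<longlongrightarrow> 0) F2"
proof -
  define U where "U lam = (SOME v. localized_solution lam v)" for lam
  have U: "localized_solution lam (U lam)" if "0 < lam" for lam
    unfolding U_def using ex[OF that] by (rule someI_ex)
  have "filterlim (\<lambda>lam. sup_norm01 (U lam)) at_top F1"
    unfolding filterlim_at_top_gt[of _ _ 0]
  proof (intro allI impI)
    fix Z :: real assume "0 < Z"
    from big[OF this] pos(1) show "\<forall>\<^sub>F lam in F1. Z \<le> sup_norm01 (U lam)"
      by eventually_elim (use U in blast)
  qed
  moreover have "((\<lambda>lam. sup_norm01 (U lam)) \<longlongrightarrow> 0) F2"
  proof (rule tendstoI)
    fix \<epsilon> :: real assume "0 < \<epsilon>"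
    from small[OF this] pos(2) show "\<forall>\<^sub>F lam in F2. dist (sup_norm01 (U lam)) 0 < \<epsilon>"
    proof eventually_elim
      case (elim lam)
      then show ?case using U[of lam] by (simp add: localized_solution_def)
    qed
  qed
  ultimately show ?thesis
    using U by (auto simp: localized_solution_def)
qed

section \<open>Asymptotics of the norms\<close>

context
  assumes c_cont: "continuous_on {0..1} c" and d_cont: "continuous_on {0..1} d"
    and f_pos: "\<And>s. 0 < s \<Longrightarrow> 0 < f s"
begin

lemma quotient_bounds:
  assumes "0 < x"
  obtains m M where "0 < m" "0 < M" "\<And>s. s \<in> {x..y} \<Longrightarrow> m * \<phi> s \<le> f s \<and> f s \<le> M * \<phi> s"
proof -
  define g where "g s = f s / \<phi> s" for s
  \<comment> \<open>Keeps the interval nonempty when \<open>y < x\<close>.\<close>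
  define z where "z = max x y"
  have z: "x \<in> {x..z}" by (simp add: z_def)
  have "continuous_on {x..z} g"
    unfolding g_def
    by (intro continuous_intros continuous_on_subset[OF f_cont] continuous_on_subset[OF phi_cont])
       (use assms in \<open>auto simp: less_imp_neq[symmetric]\<close>)
  then obtain s1 s2 where s: "s1 \<in> {x..z}" "s2 \<in> {x..z}" "\<And>s. s \<in> {x..z} \<Longrightarrow> g s1 \<le> g s \<and> g s \<le> g s2"
    using continuous_attains_inf[of "{x..z}" g] continuous_attains_sup[of "{x..z}" g] z by (metis compact_Icc empty_iff)
  have pos: "0 < g s" if "s \<in> {x..z}" for s
    using that assms f_pos[of s] by (simp add: g_def)
  show thesis
  proof (rule that[of "g s1" "g s2"])
    fix t assume t: "t \<in> {x..y}"
    then have "0 < \<phi> t" "t \<in> {x..z}" using assms by (auto simp: z_def)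
    then show "g s1 * \<phi> t \<le> f t \<and> f t \<le> g s2 * \<phi> t"
      using s(3)[of t] by (simp add: g_def field_simps)
  qed (use pos s in auto)
qed

lemma quotient_small:
  assumes "((\<lambda>s. f s / \<phi> s) \<longlongrightarrow> 0) (at_right 0)" "0 < \<epsilon>"
  obtains S where "0 < S" "\<And>s. 0 < s \<Longrightarrow> s \<le> S \<Longrightarrow> f s \<le> \<epsilon> * \<phi> s"
proof -
  have "\<forall>\<^sub>F s in at_right 0. f s / \<phi> s < \<epsilon>"
    using order_tendstoD(2)[OF assms] .
  then obtain S where S: "0 < S" "\<And>s. 0 < s \<Longrightarrow> s < S \<Longrightarrow> f s / \<phi> s < \<epsilon>"
    unfolding eventually_at_right_field by blast
  have "f s \<le> \<epsilon> * \<phi> s" if "0 < s" "s \<le> S / 2" for s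
    using S(2)[of s] that S(1) by (simp add: field_simps)
  then show thesis using that[of "S / 2"] S(1) by simp
qed

lemma quotient_large:
  assumes "filterlim (\<lambda>s. f s / \<phi> s) at_top (at_right 0)"
  obtains S where "0 < S" "\<And>s. 0 < s \<Longrightarrow> s \<le> S \<Longrightarrow> K * \<phi> s \<le> f s"
proof -
  have "\<forall>\<^sub>F s in at_right 0. K \<le> f s / \<phi> s"
    using assms by (simp add: filterlim_at_top)
  then obtain S where S: "0 < S" "\<And>s. 0 < s \<Longrightarrow> s < S \<Longrightarrow> K \<le> f s / \<phi> s"
    unfolding eventually_at_right_field by blast
  have "K * \<phi> s \<le> f s" if "0 < s" "s \<le> S / 2" for s
    using S(2)[of s] that S(1) by (simp add: field_simps)
  then show thesis using that[of "S / 2"] S(1) by simp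
qed

lemma quotient_large_at_top:
  assumes "filterlim (\<lambda>s. f s / \<phi> s) at_top at_top"
  obtains S where "0 < S" "\<And>s. S \<le> s \<Longrightarrow> K * \<phi> s \<le> f s"
proof -
  have "\<forall>\<^sub>F s in at_top. K \<le> f s / \<phi> s"
    using assms by (simp add: filterlim_at_top)
  then obtain S where S: "\<And>s. S \<le> s \<Longrightarrow> K \<le> f s / \<phi> s"
    unfolding eventually_at_top_linorder by blast
  have "K * \<phi> s \<le> f s" if "max S 1 \<le> s" for s
    using S[of s] that by (simp add: field_simps)
  then show thesis using that[of "max S 1"] by simp
qed

text \<open>The additive constant absorbs small arguments, where \<open>f s / \<phi> s\<close> is
  unbounded in the sublinear case.\<close>

lemma quotient_small_at_top:
  assumes "((\<lambda>s. f s / \<phi> s) \<longlongrightarrow> 0) at_top" "0 < \<epsilon>"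
  obtains M where "0 \<le> M" "\<And>s. 0 \<le> s \<Longrightarrow> f s \<le> M + \<epsilon> * \<phi> s"
proof -
  have "\<forall>\<^sub>F s in at_top. f s / \<phi> s < \<epsilon>"
    using order_tendstoD(2)[OF assms] .
  then obtain S where S: "\<And>s. S \<le> s \<Longrightarrow> f s / \<phi> s < \<epsilon>"
    unfolding eventually_at_top_linorder by blast
  have "continuous_on {0..max S 1} f"
    by (rule continuous_on_subset[OF f_cont]) auto
  then obtain z where z: "z \<in> {0..max S 1}" "\<And>s. s \<in> {0..max S 1} \<Longrightarrow> f s \<le> f z"
    using continuous_attains_sup[of "{0..max S 1}" f] by (auto simp: max_def split: if_splits)
  have fz: "0 \<le> f z" using f_nonneg[of z] z(1) by simp
  have "f s \<le> f z + \<epsilon> * \<phi> s" if s: "0 \<le> s" for s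
  proof (cases "s \<le> max S 1")
    case True
    then show ?thesis using z(2)[of s] s assms(2) by (simp add: add_increasing2)
  next
    case False
    then have "f s < \<epsilon> * \<phi> s" using S[of s] by (simp add: pos_divide_less_eq)
    then show ?thesis using fz by simp
  qed
  then show thesis using that[of "f z"] fz by blast
qed

lemma superlinear_branch:
  assumes f0: "((\<lambda>s. f s / \<phi> s) \<longlongrightarrow> 0) (at_right 0)"
    and finf: "filterlim (\<lambda>s. f s / \<phi> s) at_top at_top"
  shows "\<exists>U. (\<forall>lam>0. is_positive_solution \<phi> c d h f lam (U lam)) \<and>
    filterlim (\<lambda>lam. sup_norm01 (U lam)) at_top (at_right 0) \<and>
    ((\<lambda>lam. sup_norm01 (U lam)) \<longlongrightarrow> 0) at_top"
proof (rule solution_branch)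
  \<comment> \<open>The sphere condition includes the argument 0, about which the quotient says
    nothing; \<open>f 0\<close> is recovered as the limit of
    \<open>(f s / \<phi> s) * \<phi> s\<close>.\<close>
  have f_0: "f 0 = 0"
  proof (rule tendsto_unique[of "at_right 0"])
    have "(f \<longlongrightarrow> f 0) (at 0 within {0..})"
      using f_cont by (simp add: continuous_on)
    then show "(f \<longlongrightarrow> f 0) (at_right 0)"
      by (rule tendsto_within_subset) auto
    have "(\<phi> \<longlongrightarrow> \<phi> 0) (at 0)" using phi_cont unfolding continuous_on_def by blast
    then have "(\<phi> \<longlongrightarrow> 0) (at_right 0)" by (simp add: filterlim_at_split)
    then have "((\<lambda>s. f s / \<phi> s * \<phi> s) \<longlongrightarrow> 0 * 0) (at_right 0)"
      by (rule tendsto_mult[OF f0])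
    moreover have "\<forall>\<^sub>F s in at_right (0::real). f s / \<phi> s * \<phi> s = f s"
      unfolding eventually_at_right_field
      by (intro exI[of _ 1]) (auto simp: less_imp_neq[symmetric])
    ultimately show "(f \<longlongrightarrow> 0) (at_right 0)"
      by (simp add: tendsto_cong)
  qed auto
  show "\<exists>v. localized_solution lam v" if lam: "0 < lam" for lam
  proof -
    obtain r1 where r1: "0 < r1" "\<And>s. 0 < s \<Longrightarrow> s \<le> r1 \<Longrightarrow> f s \<le> \<kappa>1 / lam * \<phi> s"
      using quotient_small[OF f0, of "\<kappa>1 / lam"] \<kappa>1_pos lam by (metis divide_pos_pos)
    obtain S where S: "0 < S" "\<And>s. S \<le> s \<Longrightarrow> \<kappa>2 / lam * \<phi> s \<le> f s"
      using quotient_large_at_top[OF finf, of "\<kappa>2 / lam"] by blast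
    define r2 where "r2 = max (S / \<theta>) (r1 + 1)"
    have "lam * f s \<le> \<kappa>1 * \<phi> r1" if "s \<in> {0..r1}" for s
    proof (cases "s = 0")
      case False
      then have "lam * f s \<le> lam * (\<kappa>1 / lam * \<phi> s)"
        using r1(2)[of s] that lam by (intro mult_left_mono) auto
      also have "\<dots> = \<kappa>1 * \<phi> s" using lam by simp
      also have "\<dots> \<le> \<kappa>1 * \<phi> r1" using that \<kappa>1_pos by (intro mult_left_mono) auto
      finally show ?thesis .
    qed (use f_0 \<kappa>1_pos r1(1) in simp)
    moreover have "\<kappa>2 * \<phi> s \<le> lam * f s" if "s \<in> {\<theta> * r2..r2}" for s
    proof -
      have "S / \<theta> \<le> r2" by (simp add: r2_def)
      then have "S \<le> \<theta> * r2" using \<theta> by (simp add: field_simps)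
      then have "lam * (\<kappa>2 / lam * \<phi> s) \<le> lam * f s"
        using S(2)[of s] that lam by (intro mult_left_mono) auto
      then show ?thesis using lam by simp
    qed
    ultimately show ?thesis
      by (intro localized_solution_exists[OF c_cont d_cont lam r1(1), of r2] disjI1) (auto simp: r2_def)
  qed
  \<comment> \<open>A norm \<open>R < Z\<close> and the witness \<open>x\<close> give
    \<open>\<kappa>1 * \<phi> R \<le> lam * B * \<phi> R\<close>, which is impossible for
    \<open>lam < \<kappa>1 / B\<close>.\<close>
  show "\<forall>\<^sub>F lam in at_right 0. \<forall>v. localized_solution lam v \<longrightarrow> Z \<le> sup_norm01 v" if Z: "0 < Z" for Z :: real
  proof -
    obtain S where S: "0 < S" "\<And>s. 0 < s \<Longrightarrow> s \<le> S \<Longrightarrow> f s \<le> 1 * \<phi> s"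
      using quotient_small[OF f0, of 1] by auto
    obtain m M where M: "0 < M" "\<And>s. s \<in> {S..Z} \<Longrightarrow> m * \<phi> s \<le> f s \<and> f s \<le> M * \<phi> s"
      using quotient_bounds[OF S(1), of Z] by metis
    define B where "B = max 1 M"
    have B: "0 < B" by (simp add: B_def)
    have fB: "f s \<le> B * \<phi> s" if s: "0 \<le> s" "s \<le> Z" for s
    proof -
      consider "s = 0" | "0 < s" "s \<le> S" | "S \<le> s" using s by linarith
      then show ?thesis
      proof cases
        case 2
        have "1 * \<phi> s \<le> B * \<phi> s" using s by (intro mult_right_mono) (auto simp: B_def)
        then show ?thesis using S(2)[OF 2] by linarith
      next
        case 3
        have "M * \<phi> s \<le> B * \<phi> s" using s by (intro mult_right_mono) (auto simp: B_def)
        then show ?thesis using M(2)[of s] 3 s by simp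
      qed (simp add: f_0)
    qed
    have "Z \<le> sup_norm01 v" if lam: "0 < lam" "lam < \<kappa>1 / B" and v: "localized_solution lam v" for lam v
    proof (rule ccontr)
      define R where "R = sup_norm01 v"
      assume "\<not> Z \<le> sup_norm01 v"
      then have R: "0 < R" "R \<le> Z" using v by (auto simp: R_def localized_solution_def)
      obtain x where x: "x \<in> {0..R}" "\<kappa>1 * \<phi> R \<le> lam * f x"
        using v by (auto simp: R_def localized_solution_def)
      have "f x \<le> B * \<phi> x" using fB x R by simp
      also have "\<dots> \<le> B * \<phi> R" using x B by (intro mult_left_mono) auto
      finally have "\<kappa>1 * \<phi> R \<le> lam * (B * \<phi> R)"
        using x(2) lam by (meson mult_left_mono less_imp_le order_trans)
      then have "\<kappa>1 * \<phi> R \<le> (lam * B) * \<phi> R" by (simp add: mult.assoc)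
      then have "\<kappa>1 \<le> lam * B" by (rule mult_right_le_imp_le) (use R in simp)
      then show False using lam B by (simp add: field_simps)
    qed
    moreover have "0 < \<kappa>1 / B" using \<kappa>1_pos B by simp
    ultimately show ?thesis
      unfolding eventually_at_right_field by blast
  qed
  \<comment> \<open>A norm of at least \<epsilon> puts the witness \<open>y\<close> above
    \<open>\<theta> * \<epsilon>\<close>, where \<open>f\<close> is at least
    \<open>B * \<phi>\<close>; then \<open>lam * B \<le> \<kappa>2\<close>.\<close>
  show "\<forall>\<^sub>F lam in at_top. \<forall>v. localized_solution lam v \<longrightarrow> sup_norm01 v < \<epsilon>" if \<epsilon>: "0 < \<epsilon>" for \<epsilon> :: real
  proof -
    obtain S where S: "0 < S" "\<And>s. S \<le> s \<Longrightarrow> 1 * \<phi> s \<le> f s"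
      using quotient_large_at_top[OF finf, of 1] by auto
    have \<theta>\<epsilon>: "0 < \<theta> * \<epsilon>" using \<theta> \<epsilon> by simp
    obtain m M where m: "0 < m" "\<And>s. s \<in> {\<theta> * \<epsilon>..S} \<Longrightarrow> m * \<phi> s \<le> f s \<and> f s \<le> M * \<phi> s"
      using quotient_bounds[OF \<theta>\<epsilon>, of S] by metis
    define B where "B = min 1 m"
    have B: "0 < B" using m by (simp add: B_def)
    have fB: "B * \<phi> s \<le> f s" if s: "\<theta> * \<epsilon> \<le> s" for s
    proof -
      have "0 < s" using s \<theta>\<epsilon> by simp
      then have "B * \<phi> s \<le> 1 * \<phi> s" "B * \<phi> s \<le> m * \<phi> s"
        by (auto intro!: mult_right_mono simp: B_def)
      moreover have "1 * \<phi> s \<le> f s \<or> m * \<phi> s \<le> f s"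
        using S(2)[of s] m(2)[of s] s by (cases "S \<le> s") auto
      ultimately show ?thesis by linarith
    qed
    have "sup_norm01 v < \<epsilon>" if lam: "max 1 (\<kappa>2 / B + 1) \<le> lam" and v: "localized_solution lam v" for lam v
    proof (rule ccontr)
      define R where "R = sup_norm01 v"
      assume "\<not> sup_norm01 v < \<epsilon>"
      then have R: "\<epsilon> \<le> R" by (simp add: R_def)
      obtain y where y: "y \<in> {\<theta> * R..R}" "lam * f y \<le> \<kappa>2 * \<phi> y"
        using v by (auto simp: R_def localized_solution_def)
      have "\<theta> * \<epsilon> \<le> \<theta> * R" using R \<theta> by simp
      then have y\<epsilon>: "\<theta> * \<epsilon> \<le> y" using y(1) by simp
      have "lam * (B * \<phi> y) \<le> \<kappa>2 * \<phi> y"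
        by (rule order_trans[OF mult_left_mono[OF fB[OF y\<epsilon>]] y(2)]) (use lam in simp)
      then have "(lam * B) * \<phi> y \<le> \<kappa>2 * \<phi> y" by (simp add: mult.assoc)
      then have "lam * B \<le> \<kappa>2" by (rule mult_right_le_imp_le) (use y\<epsilon> \<theta>\<epsilon> in simp)
      then have "lam \<le> \<kappa>2 / B" using B by (simp add: field_simps)
      then show False using lam by simp
    qed
    then show ?thesis
      unfolding eventually_at_top_linorder by blast
  qed
qed (auto simp: eventually_at_right_less eventually_gt_at_top)

lemma sublinear_branch:
  assumes f0: "filterlim (\<lambda>s. f s / \<phi> s) at_top (at_right 0)"
    and finf: "((\<lambda>s. f s / \<phi> s) \<longlongrightarrow> 0) at_top"
  shows "\<exists>U. (\<forall>lam>0. is_positive_solution \<phi> c d h f lam (U lam)) \<and>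
    filterlim (\<lambda>lam. sup_norm01 (U lam)) at_top at_top \<and>
    ((\<lambda>lam. sup_norm01 (U lam)) \<longlongrightarrow> 0) (at_right 0)"
proof (rule solution_branch)
  show "\<exists>v. localized_solution lam v" if lam: "0 < lam" for lam
  proof -
    obtain r1 where r1: "0 < r1" "\<And>s. 0 < s \<Longrightarrow> s \<le> r1 \<Longrightarrow> \<kappa>2 / lam * \<phi> s \<le> f s"
      using quotient_large[OF f0, of "\<kappa>2 / lam"] by blast
    have "0 < \<kappa>1 / (2 * lam)" using \<kappa>1_pos lam by simp
    then obtain M where M: "0 \<le> M" "\<And>s. 0 \<le> s \<Longrightarrow> f s \<le> M + \<kappa>1 / (2 * lam) * \<phi> s"
      using quotient_small_at_top[OF finf] by blast
    \<comment> \<open>The constant \<open>M\<close> takes half of the budget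
      \<open>\<kappa>1 * \<phi> r2\<close>; the coefficient \<open>\<kappa>1 / (2 * lam)\<close>
      takes the other half.\<close>
    define r2 where "r2 = max (r1 + 1) (P (2 * lam * M / \<kappa>1))"
    have "\<phi> (P (2 * lam * M / \<kappa>1)) \<le> \<phi> r2" unfolding phi_le_iff by (simp add: r2_def)
    then have r2: "2 * lam * M \<le> \<kappa>1 * \<phi> r2" using \<kappa>1_pos by (simp add: field_simps)
    have "lam * f s \<le> \<kappa>1 * \<phi> r2" if "s \<in> {0..r2}" for s
    proof -
      have "lam * f s \<le> lam * (M + \<kappa>1 / (2 * lam) * \<phi> s)"
        using M(2)[of s] that lam by (intro mult_left_mono) auto
      also have "\<dots> = lam * M + \<kappa>1 * \<phi> s / 2" using lam by (simp add: field_simps)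
      also have "\<dots> \<le> lam * M + \<kappa>1 * \<phi> r2 / 2"
        using that \<kappa>1_pos by (intro add_left_mono divide_right_mono mult_left_mono) auto
      finally show ?thesis using r2 by simp
    qed
    moreover have "\<kappa>2 * \<phi> s \<le> lam * f s" if "s \<in> {\<theta> * r1..r1}" for s
    proof -
      have "0 < \<theta> * r1" using \<theta> r1 by simp
      then have "lam * (\<kappa>2 / lam * \<phi> s) \<le> lam * f s"
        using r1(2)[of s] that lam by (intro mult_left_mono) auto
      then show ?thesis using lam by simp
    qed
    ultimately show ?thesis
      by (intro localized_solution_exists[OF c_cont d_cont lam r1(1), of r2] disjI2) (auto simp: r2_def)
  qed
  \<comment> \<open>Compared with the superlinear case the witnesses change roles: \<open>y\<close>
    now rules out small norms for large \<open>lam\<close>, and \<open>x\<close> large norms for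
    small \<open>lam\<close>.\<close>
  show "\<forall>\<^sub>F lam in at_top. \<forall>v. localized_solution lam v \<longrightarrow> Z \<le> sup_norm01 v" if Z: "0 < Z" for Z :: real
  proof -
    obtain S where S: "0 < S" "\<And>s. 0 < s \<Longrightarrow> s \<le> S \<Longrightarrow> 1 * \<phi> s \<le> f s"
      using quotient_large[OF f0, of 1] by auto
    obtain m M where m: "0 < m" "\<And>s. s \<in> {S..Z} \<Longrightarrow> m * \<phi> s \<le> f s \<and> f s \<le> M * \<phi> s"
      using quotient_bounds[OF S(1), of Z] by metis
    define B where "B = min 1 m"
    have B: "0 < B" using m by (simp add: B_def)
    have fB: "B * \<phi> s \<le> f s" if s: "0 < s" "s \<le> Z" for s
    proof -
      have "B * \<phi> s \<le> 1 * \<phi> s" "B * \<phi> s \<le> m * \<phi> s"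
        using s by (auto intro!: mult_right_mono simp: B_def)
      moreover have "1 * \<phi> s \<le> f s \<or> m * \<phi> s \<le> f s"
        using S(2)[of s] m(2)[of s] s by (cases "S \<le> s") auto
      ultimately show ?thesis by linarith
    qed
    have "Z \<le> sup_norm01 v" if lam: "max 1 (\<kappa>2 / B + 1) \<le> lam" and v: "localized_solution lam v" for lam v
    proof (rule ccontr)
      define R where "R = sup_norm01 v"
      assume "\<not> Z \<le> sup_norm01 v"
      then have R: "0 < R" "R \<le> Z" using v by (auto simp: R_def localized_solution_def)
      obtain y where y: "y \<in> {\<theta> * R..R}" "lam * f y \<le> \<kappa>2 * \<phi> y"
        using v by (auto simp: R_def localized_solution_def)
      have "0 < \<theta> * R" using R \<theta> by simp
      then have y0: "0 < y" "y \<le> Z" using y(1) R by auto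
      have "lam * (B * \<phi> y) \<le> \<kappa>2 * \<phi> y"
        by (rule order_trans[OF mult_left_mono[OF fB[OF y0]] y(2)]) (use lam in simp)
      then have "(lam * B) * \<phi> y \<le> \<kappa>2 * \<phi> y" by (simp add: mult.assoc)
      then have "lam * B \<le> \<kappa>2" by (rule mult_right_le_imp_le) (use y0 in simp)
      then have "lam \<le> \<kappa>2 / B" using B by (simp add: field_simps)
      then show False using lam by simp
    qed
    then show ?thesis
      unfolding eventually_at_top_linorder by blast
  qed
  show "\<forall>\<^sub>F lam in at_right 0. \<forall>v. localized_solution lam v \<longrightarrow> sup_norm01 v < \<epsilon>" if \<epsilon>: "0 < \<epsilon>" for \<epsilon> :: real
  proof -
    obtain M where M: "0 \<le> M" "\<And>s. 0 \<le> s \<Longrightarrow> f s \<le> M + 1 * \<phi> s"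
      using quotient_small_at_top[OF finf zero_less_one] by blast
    \<comment> \<open>Makes \<open>M + \<phi> R \<le> B * \<phi> R\<close> for every
      \<open>R \<ge> \<epsilon>\<close>.\<close>
    define B where "B = M / \<phi> \<epsilon> + 1"
    have B: "0 < B" using M \<epsilon> by (simp add: B_def add_nonneg_pos)
    have "sup_norm01 v < \<epsilon>" if lam: "0 < lam" "lam < \<kappa>1 / B" and v: "localized_solution lam v" for lam v
    proof (rule ccontr)
      define R where "R = sup_norm01 v"
      assume "\<not> sup_norm01 v < \<epsilon>"
      then have R: "\<epsilon> \<le> R" by (simp add: R_def)
      have \<phi>R: "0 < \<phi> R" using R \<epsilon> by simp
      obtain x where x: "x \<in> {0..R}" "\<kappa>1 * \<phi> R \<le> lam * f x"
        using v by (auto simp: R_def localized_solution_def)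
      have "M / \<phi> \<epsilon> * \<phi> \<epsilon> \<le> M / \<phi> \<epsilon> * \<phi> R"
        using R \<epsilon> M(1) by (intro mult_left_mono) auto
      then have "M \<le> M / \<phi> \<epsilon> * \<phi> R" using \<epsilon> by (simp add: less_imp_neq[symmetric])
      moreover have "\<phi> x \<le> \<phi> R" using x by simp
      moreover have "f x \<le> M + \<phi> x" using M(2)[of x] x(1) by simp
      ultimately have "f x \<le> B * \<phi> R"
        unfolding B_def distrib_right mult_1 by linarith
      then have "\<kappa>1 * \<phi> R \<le> lam * (B * \<phi> R)"
        using x(2) lam by (meson mult_left_mono less_imp_le order_trans)
      then have "\<kappa>1 * \<phi> R \<le> (lam * B) * \<phi> R" by (simp add: mult.assoc)
      then have "\<kappa>1 \<le> lam * B" by (rule mult_right_le_imp_le) (rule \<phi>R)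
      then show False using lam B by (simp add: field_simps)
    qed
    moreover have "0 < \<kappa>1 / B" using \<kappa>1_pos B by simp
    ultimately show ?thesis
      unfolding eventually_at_right_field by blast
  qed
qed (auto simp: eventually_at_right_less eventually_gt_at_top)

end

end

section \<open>The main theorem\<close>

lemma positive_on_neighbourhood:
  fixes h :: "real \<Rightarrow> real"
  assumes "continuous_on {0<..<1} h" "\<forall>t\<in>{0<..<1}. h t \<ge> 0" "\<exists>t\<in>{0<..<1}. h t \<noteq> 0"
  obtains a b \<eta> where "0 < a" "a < b" "b < 1" "0 < \<eta>" "\<And>t. t \<in> {a..b} \<Longrightarrow> \<eta> \<le> h t"
proof -
  obtain t0 where t0: "t0 \<in> {0<..<1}" "0 < h t0"
    using assms(2,3) by force
  obtain e where e: "0 < e" "\<And>t. t \<in> {0<..<1} \<Longrightarrow> dist t t0 < e \<Longrightarrow> dist (h t) (h t0) < h t0 / 2"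
    using assms(1) t0 unfolding continuous_on_iff by (metis half_gt_zero)
  define q where "q = min (e / 2) (min t0 (1 - t0) / 2)"
  have q: "0 < q" "q < t0" "q < 1 - t0" "q < e" using e(1) t0(1) by (auto simp: q_def min_def)
  show thesis
  proof (rule that[of "t0 - q" "t0 + q" "h t0 / 2"])
    fix t assume "t \<in> {t0 - q..t0 + q}"
    then have "dist (h t) (h t0) < h t0 / 2"
      using q by (intro e(2)) (auto simp: dist_real_def)
    then show "h t0 / 2 \<le> h t" by (simp add: dist_real_def abs_if split: if_splits)
  qed (use q t0 in auto)
qed

lemma continuous_positive_bounds:
  fixes g :: "real \<Rightarrow> real"
  assumes "continuous_on {0..1} g" "\<forall>t\<in>{0..1}. g t > 0"
  obtains m M where "0 < m" "\<And>t. t \<in> {0..1} \<Longrightarrow> m \<le> g t \<and> g t \<le> M"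
proof -
  have ne: "{0..1::real} \<noteq> {}" by simp
  obtain x where x: "x \<in> {0..1}" "\<And>t. t \<in> {0..1} \<Longrightarrow> g x \<le> g t"
    using continuous_attains_inf[OF compact_Icc ne assms(1)] by blast
  obtain y where "\<And>t. t \<in> {0..1} \<Longrightarrow> g t \<le> g y"
    using continuous_attains_sup[OF compact_Icc ne assms(1)] by blast
  then show thesis using that[of "g x" "g y"] x assms(2) by blast
qed

theorem theorem3p7:
  fixes \<phi> \<psi>1 \<psi>2 c d f h :: "real \<Rightarrow> real"
  assumes phi: "odd_incr_homeo \<phi>"
    and A: "condA \<phi> \<psi>1 \<psi>2"
    and c: "continuous_on {0..1} c" "\<forall>t\<in>{0..1}. c t > 0"
    and d: "continuous_on {0..1} d" "\<forall>t\<in>{0..1}. d t > 0"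
    and f: "continuous_on {0..} f" "\<forall>s\<ge>0. f s \<ge> 0" "\<forall>s>0. f s > 0"
    and h: "continuous_on {0<..<1} h" "\<forall>t\<in>{0<..<1}. h t \<ge> 0" "\<exists>t\<in>{0<..<1}. h t \<noteq> 0"
    and hint: "h_integrability \<psi>1 h"
    and gam: "0 \<le> alpha_h h" "alpha_h h < gamma1_h h" "gamma1_h h < gamma2_h h"
             "gamma2_h h < beta_h h" "beta_h h \<le> 1"
  shows
    "(((\<lambda>s. f s / \<phi> s) \<longlongrightarrow> 0) (at_right 0) \<and> filterlim (\<lambda>s. f s / \<phi> s) at_top at_top \<longrightarrow>
       (\<exists>U. (\<forall>lam>0. is_positive_solution \<phi> c d h f lam (U lam)) \<and>
            filterlim (\<lambda>lam. sup_norm01 (U lam)) at_top (at_right 0) \<and>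
            ((\<lambda>lam. sup_norm01 (U lam)) \<longlongrightarrow> 0) at_top))
   \<and> (filterlim (\<lambda>s. f s / \<phi> s) at_top (at_right 0) \<and> ((\<lambda>s. f s / \<phi> s) \<longlongrightarrow> 0) at_top \<longrightarrow>
       (\<exists>U. (\<forall>lam>0. is_positive_solution \<phi> c d h f lam (U lam)) \<and>
            ((\<lambda>lam. sup_norm01 (U lam)) \<longlongrightarrow> 0) (at_right 0) \<and>
            filterlim (\<lambda>lam. sup_norm01 (U lam)) at_top at_top))"
proof -
  interpret phi_laplacian \<phi> \<psi>1 \<psi>2 by unfold_locales (fact phi A)+
  obtain H \<Gamma> where H: "H (1/2) = 0" "\<And>t. t \<in> {0<..<1} \<Longrightarrow> (H has_real_derivative h t) (at t)"
    and \<Gamma>: "continuous_on {0..1} \<Gamma>" "\<And>t. t \<in> {0<..<1} \<Longrightarrow> (\<Gamma> has_real_derivative P1 \<bar>H t\<bar>) (at t)"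
    using integrated_profile[OF h(1) _ hint] h(2) by blast
  obtain a b \<eta> where ab: "0 < a" "a < b" "b < 1" and \<eta>: "0 < \<eta>" "\<And>t. t \<in> {a..b} \<Longrightarrow> \<eta> \<le> h t"
    using positive_on_neighbourhood[OF h] by blast
  obtain c0 c1 where c01: "0 < c0" "\<And>t. t \<in> {0..1} \<Longrightarrow> c0 \<le> c t \<and> c t \<le> c1"
    using continuous_positive_bounds[OF c] by blast
  obtain d0 d1 where d01: "0 < d0" "\<And>t. t \<in> {0..1} \<Longrightarrow> d0 \<le> d t \<and> d t \<le> d1"
    using continuous_positive_bounds[OF d] by blast
  interpret sphere_estimates \<phi> \<psi>1 \<psi>2 c d c0 c1 d0 d1 f h H \<Gamma> a b \<eta>
    by unfold_locales (use c01 d01 f h H \<Gamma> ab \<eta> in auto)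
  have fp: "0 < f s" if "0 < s" for s using f(3) that by blast
  show ?thesis
    using superlinear_branch[OF c(1) d(1) fp] sublinear_branch[OF c(1) d(1) fp] by blast
qed

end
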